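(* Up to a rescaling, a geometric evolution of curves immersed in $\mathbb{R}^3$ of the form $$X_t = h_1\mathbf{T}+h_2\mathbf{N}+h_3\mathbf{B}$$ is both curvature and arc-length preserving if and only if its evolution is equivalent to $$X_t=\frac{1}{\sqrt{\tau}}\,\mathbf{B}.$$
   Context: $\gamma(t)$ is a family of smooth curves immersed in $\mathbb{R}^3$ with strictly positive torsion, and $X(s,t)$ is a parametrization of $\gamma(t)$ by arc-length $s$. $\{\mathbf{T},\mathbf{N},\mathbf{B}\}$ is the Frenet-Serret frame (unit tangent, normal, binormal), and $\kappa$ and $\tau$ denote the curvature and torsion. The coefficients $h_1,h_2,h_3$ are arbitrary smooth functions of $\kappa$ and $\tau$ on $\gamma(t)$. The evolution is arc-length preserving if arc-length along the curves is unchanged in time, and curvature preserving if $\kappa_t=0$.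
   Formalization: The coefficients h1, h2, h3 are assumed not all identically zero, since the stationary evolution X_t = 0 preserves curvature and arc-length but is not a rescaling of X_t = B/√τ. *)

theory Defs
  imports "HOL-Analysis.Analysis"
begin

text \<open>Smoothness on open sets (on other sets the two-sided derivatives below are not the
  intended notion).\<close>

primrec Ck_on :: "nat \<Rightarrow> 'a::euclidean_space set \<Rightarrow> ('a \<Rightarrow> 'b::euclidean_space) \<Rightarrow> bool" where
  "Ck_on 0 S f \<longleftrightarrow> continuous_on S f"
| "Ck_on (Suc k) S f \<longleftrightarrow>
     (\<forall>x\<in>S. f differentiable (at x)) \<and> (\<forall>v. Ck_on k S (\<lambda>x. frechet_derivative f (at x) v))"

definition smooth_on :: "'a::euclidean_space set \<Rightarrow> ('a \<Rightarrow> 'b::euclidean_space) \<Rightarrow> bool" where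
  "smooth_on S f \<longleftrightarrow> (\<forall>k. Ck_on k S f)"

text \<open>Curves are given in an arbitrary regular parameter \<open>u\<close>, since a parameter that is arc-length
  at one time need not remain so under a general evolution. Arc-length enters through
  \<open>d/ds = (1/|\<gamma>'|) d/du\<close>; if \<open>u\<close> is itself arc-length, then \<open>d/ds = d/du\<close>.\<close>

definition speed :: "(real \<Rightarrow> real^3) \<Rightarrow> real \<Rightarrow> real" where
  "speed \<gamma> u = norm (vector_derivative \<gamma> (at u))"

definition arc_length :: "(real \<Rightarrow> real^3) \<Rightarrow> real \<Rightarrow> real \<Rightarrow> real" where
  "arc_length \<gamma> a b = integral {a..b} (speed \<gamma>)"

definition arc_deriv :: "(real \<Rightarrow> real^3) \<Rightarrow> (real \<Rightarrow> real^3) \<Rightarrow> real \<Rightarrow> real^3" where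
  "arc_deriv \<gamma> F u = vector_derivative F (at u) /\<^sub>R speed \<gamma> u"

definition tangent :: "(real \<Rightarrow> real^3) \<Rightarrow> real \<Rightarrow> real^3" where
  "tangent \<gamma> = arc_deriv \<gamma> \<gamma>"

definition curvature :: "(real \<Rightarrow> real^3) \<Rightarrow> real \<Rightarrow> real" where
  "curvature \<gamma> u = norm (arc_deriv \<gamma> (tangent \<gamma>) u)"

definition normal :: "(real \<Rightarrow> real^3) \<Rightarrow> real \<Rightarrow> real^3" where
  "normal \<gamma> u = arc_deriv \<gamma> (tangent \<gamma>) u /\<^sub>R curvature \<gamma> u"

definition binormal :: "(real \<Rightarrow> real^3) \<Rightarrow> real \<Rightarrow> real^3" where
  "binormal \<gamma> u = cross3 (tangent \<gamma> u) (normal \<gamma> u)"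

text \<open>Sign convention: \<open>dN/ds = - \<kappa> T + \<tau> B\<close>, so right-handed helices have positive torsion.\<close>

definition torsion :: "(real \<Rightarrow> real^3) \<Rightarrow> real \<Rightarrow> real" where
  "torsion \<gamma> u = arc_deriv \<gamma> (normal \<gamma>) u \<bullet> binormal \<gamma> u"

definition positive_torsion_curve :: "real set \<Rightarrow> (real \<Rightarrow> real^3) \<Rightarrow> bool" where
  "positive_torsion_curve I \<gamma> \<longleftrightarrow>
     open I \<and> is_interval I \<and> smooth_on I \<gamma> \<and>
     (\<forall>u\<in>I. vector_derivative \<gamma> (at u) \<noteq> 0 \<and> curvature \<gamma> u > 0 \<and> torsion \<gamma> u > 0)"

text \<open>\<open>X u t\<close> is the point with parameter \<open>u\<close> on the curve at time \<open>t\<close>.\<close>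

definition curve_family :: "real set \<Rightarrow> real set \<Rightarrow> (real \<Rightarrow> real \<Rightarrow> real^3) \<Rightarrow> bool" where
  "curve_family I J X \<longleftrightarrow>
     open J \<and> is_interval J \<and> smooth_on (I \<times> J) (\<lambda>(u, t). X u t) \<and>
     (\<forall>t\<in>J. positive_torsion_curve I (\<lambda>u. X u t))"

text \<open>The evolution law \<open>X\<^sub>t = h1 T + h2 N + h3 B\<close>. The coefficients are functions of the pair
  \<open>(\<kappa>, \<tau>)\<close>; only their values for \<open>\<kappa> > 0\<close>, \<open>\<tau> > 0\<close> are relevant.\<close>

type_synonym coeff = "real \<times> real \<Rightarrow> real"

definition curvature_domain :: "(real \<times> real) set" where
  "curvature_domain = {(k, w). k > 0 \<and> w > 0}"

definition velocity :: "coeff \<Rightarrow> coeff \<Rightarrow> coeff \<Rightarrow> (real \<Rightarrow> real^3) \<Rightarrow> real \<Rightarrow> real^3" where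
  "velocity h1 h2 h3 \<gamma> u =
     h1 (curvature \<gamma> u, torsion \<gamma> u) *\<^sub>R tangent \<gamma> u +
     h2 (curvature \<gamma> u, torsion \<gamma> u) *\<^sub>R normal \<gamma> u +
     h3 (curvature \<gamma> u, torsion \<gamma> u) *\<^sub>R binormal \<gamma> u"

definition evolves_at ::
  "coeff \<Rightarrow> coeff \<Rightarrow> coeff \<Rightarrow> real set \<Rightarrow> (real \<Rightarrow> real \<Rightarrow> real^3) \<Rightarrow> real \<Rightarrow> bool" where
  "evolves_at h1 h2 h3 I X t \<longleftrightarrow>
     (\<forall>u\<in>I. vector_derivative (X u) (at t) = velocity h1 h2 h3 (\<lambda>u. X u t) u)"

text \<open>Preservation is a property of the law: whenever a family moves according to the law at an
  instant, the time derivatives of all arc-lengths (respectively, of the curvature) vanish at that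
  instant. The equation is imposed at that instant only, so that the property does not depend on
  which initial curves admit a solution of the evolution equation, which for arbitrary coefficients
  may be ill-posed. For solutions on a time interval the conserved quantities are constant in time;
  see \<open>arclength_constant\<close> and \<open>curvature_constant\<close> below.\<close>

definition arclength_preserving :: "coeff \<Rightarrow> coeff \<Rightarrow> coeff \<Rightarrow> bool" where
  "arclength_preserving h1 h2 h3 \<longleftrightarrow>
     (\<forall>I J X t. curve_family I J X \<and> t \<in> J \<and> evolves_at h1 h2 h3 I X t \<longrightarrow>
        (\<forall>a\<in>I. \<forall>b\<in>I. a \<le> b \<longrightarrow>
           ((\<lambda>r. arc_length (\<lambda>u. X u r) a b) has_real_derivative 0) (at t)))"

definition curvature_preserving :: "coeff \<Rightarrow> coeff \<Rightarrow> coeff \<Rightarrow> bool" where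
  "curvature_preserving h1 h2 h3 \<longleftrightarrow>
     (\<forall>I J X t. curve_family I J X \<and> t \<in> J \<and> evolves_at h1 h2 h3 I X t \<longrightarrow>
        (\<forall>u\<in>I. ((\<lambda>r. curvature (\<lambda>u. X u r) u) has_real_derivative 0) (at t)))"

text \<open>The velocities differ by a constant factor \<open>c \<noteq> 0\<close>, the same for all curves: the first
  evolution is the second one after the rescaling \<open>t \<mapsto> c t\<close> of time. The sign of \<open>c\<close> is immaterial
  for a multiple of \<open>B\<close>: reversing the orientation of a curve preserves \<open>\<kappa>\<close>, \<open>\<tau>\<close> and \<open>N\<close> and
  changes the sign of \<open>T\<close> and \<open>B\<close>.\<close>

definition equivalent_up_to_rescaling ::
  "coeff \<times> coeff \<times> coeff \<Rightarrow> coeff \<times> coeff \<times> coeff \<Rightarrow> bool" where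
  "equivalent_up_to_rescaling h g \<longleftrightarrow>
     (case (h, g) of ((h1, h2, h3), (g1, g2, g3)) \<Rightarrow>
       \<exists>c. c \<noteq> 0 \<and>
         (\<forall>I \<gamma>. positive_torsion_curve I \<gamma> \<longrightarrow>
            (\<forall>u\<in>I. velocity h1 h2 h3 \<gamma> u = c *\<^sub>R velocity g1 g2 g3 \<gamma> u)))"

lemma constant_on_interval:
  fixes f :: "real \<Rightarrow> real"
  assumes "is_interval J" and "\<And>t. t \<in> J \<Longrightarrow> (f has_real_derivative 0) (at t)"
    and "t1 \<in> J" "t2 \<in> J"
  shows "f t1 = f t2"
proof -
  have "convex J"
    using assms(1) by (simp add: is_interval_convex)
  then obtain c where "\<And>x. x \<in> J \<Longrightarrow> f x = c"
    using has_field_derivative_zero_constant[of J f] assms(2)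
    by (meson has_field_derivative_at_within)
  then show ?thesis
    using assms(3,4) by simp
qed

lemma arclength_constant:
  assumes "arclength_preserving h1 h2 h3" "curve_family I J X"
    and "\<And>t. t \<in> J \<Longrightarrow> evolves_at h1 h2 h3 I X t"
    and "a \<in> I" "b \<in> I" "a \<le> b" "t1 \<in> J" "t2 \<in> J"
  shows "arc_length (\<lambda>u. X u t1) a b = arc_length (\<lambda>u. X u t2) a b"
proof (rule constant_on_interval[of J "\<lambda>t. arc_length (\<lambda>u. X u t) a b"])
  show "is_interval J"
    using assms(2) by (simp add: curve_family_def)
  show "((\<lambda>r. arc_length (\<lambda>u. X u r) a b) has_real_derivative 0) (at t)" if "t \<in> J" for t
    using assms that unfolding arclength_preserving_def by blast
qed (use assms in auto)

lemma curvature_constant: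
  assumes "curvature_preserving h1 h2 h3" "curve_family I J X"
    and "\<And>t. t \<in> J \<Longrightarrow> evolves_at h1 h2 h3 I X t"
    and "u \<in> I" "t1 \<in> J" "t2 \<in> J"
  shows "curvature (\<lambda>u. X u t1) u = curvature (\<lambda>u. X u t2) u"
proof (rule constant_on_interval[of J "\<lambda>t. curvature (\<lambda>u. X u t) u"])
  show "is_interval J"
    using assms(2) by (simp add: curve_family_def)
  show "((\<lambda>r. curvature (\<lambda>u. X u r) u) has_real_derivative 0) (at t)" if "t \<in> J" for t
    using assms that unfolding curvature_preserving_def by blast
qed (use assms in auto)

end

theory Submission
  imports Defs
begin

text \<open>Write \<open>'\<close> for \<open>d/du\<close>, \<open>v\<close> for the speed, and let a family move at one instant with velocity
  \<open>a T + b N + c B\<close>. Exchanging \<open>\<partial>\<^sub>t\<close> and \<open>\<partial>\<^sub>u\<close> and using the Frenet equations,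
  \<open>v\<^sub>t = a' - v \<kappa> b\<close>, and if \<open>b = 0\<close> and \<open>a' = 0\<close> then \<open>v \<kappa>\<^sub>t = \<kappa>' a - \<tau>' c - 2 \<tau> c'\<close>. With
  \<open>a = b = 0\<close> both vanish for \<open>c\<close> a multiple of \<open>1/\<surd>\<tau>\<close>. Conversely, \<open>\<kappa>, \<tau>, \<kappa>', \<tau>'\<close> take arbitrary
  values (\<open>\<kappa>, \<tau> > 0\<close>) at a point of a suitable polynomial curve \<open>\<gamma>\<close>, and \<open>\<gamma> + t V\<close>, with \<open>V\<close> the prescribed
  velocity, is an admissible family near that point and \<open>t = 0\<close>. Hence \<open>h\<^sub>2 = 0\<close>, \<open>h\<^sub>1\<close> is a
  constant \<open>A\<close>, and \<open>g = h\<^sub>3 \<surd>\<tau>\<close> satisfies \<open>\<partial>g/\<partial>\<tau> = 0\<close>, \<open>\<partial>g/\<partial>\<kappa> = A / (2 \<surd>\<tau>)\<close>, which forces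
  \<open>A = 0\<close> and \<open>g\<close> constant.\<close>

subsection \<open>Calculus of smooth maps\<close>

lemma Ck_on_subset: "Ck_on k S f \<Longrightarrow> S' \<subseteq> S \<Longrightarrow> Ck_on k S' f"
  by (induction k arbitrary: f) (auto intro: continuous_on_subset)

lemma Ck_on_SucD:
  assumes "Ck_on (Suc k) S f"
  shows "x \<in> S \<Longrightarrow> (f has_derivative frechet_derivative f (at x)) (at x)"
    and "Ck_on k S (\<lambda>x. frechet_derivative f (at x) v)"
  using assms by (simp_all add: frechet_derivative_works[symmetric])

text \<open>On an open set, maps that agree on the set agree near each of its points, so their
  two-sided derivatives coincide there and the induction applies to every directional
  derivative.\<close>

lemma Ck_on_cong:
  assumes "open S" "\<And>x. x \<in> S \<Longrightarrow> f x = g x" "Ck_on k S f"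
  shows "Ck_on k S g"
  using assms(2,3)
proof (induction k arbitrary: f g)
  case 0
  then show ?case by (simp cong: continuous_on_cong)
next
  case (Suc k)
  have g: "(g has_derivative frechet_derivative f (at x)) (at x)" if "x \<in> S" for x
    by (rule has_derivative_transform_within_open[OF Ck_on_SucD(1)[OF Suc.prems(2) that] \<open>open S\<close> that Suc.prems(1)])
  have eq: "frechet_derivative f (at x) = frechet_derivative g (at x)" if "x \<in> S" for x
    using frechet_derivative_at[OF g[OF that]] .
  have "Ck_on k S (\<lambda>x. frechet_derivative g (at x) v)" for v
    by (rule Suc.IH[of "\<lambda>x. frechet_derivative f (at x) v"]) (simp_all add: eq Ck_on_SucD(2)[OF Suc.prems(2)])
  then show ?case
    using g by (auto simp: differentiable_def)
qed

text \<open>Uniqueness of the derivative lets an explicit formula \<open>F\<close> stand in for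
  \<open>frechet_derivative\<close>; the closure properties below all enter through this
  rule.\<close>

lemma Ck_on_SucI:
  assumes "open S" "\<And>x. x \<in> S \<Longrightarrow> (f has_derivative F x) (at x)"
    and "\<And>v. Ck_on k S (\<lambda>x. F x v)"
  shows "Ck_on (Suc k) S f"
proof -
  have "Ck_on k S (\<lambda>x. frechet_derivative f (at x) v)" for v
    by (rule Ck_on_cong[OF \<open>open S\<close> _ assms(3)[of v]]) (simp add: frechet_derivative_at[OF assms(2), symmetric])
  then show ?thesis
    using assms(2) by (auto simp: differentiable_def)
qed

lemma Ck_on_Suc_imp: "Ck_on (Suc k) S f \<Longrightarrow> Ck_on k S f"
proof (induction k arbitrary: f)
  case 0
  then show ?case
    by (auto intro!: differentiable_imp_continuous_on
        simp: differentiable_on_def differentiable_at_withinI)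
qed auto

lemma Ck_on_const: "open S \<Longrightarrow> Ck_on k S (\<lambda>x. c)"
  by (induction k arbitrary: c) auto

lemma Ck_on_linear:
  assumes "bounded_linear f" "open S"
  shows "Ck_on k S f"
proof (cases k)
  case 0
  then show ?thesis
    using assms by (simp add: linear_continuous_on)
next
  case (Suc n)
  show ?thesis
    unfolding Suc
    by (rule Ck_on_SucI[where F = "\<lambda>_. f"])
      (use assms bounded_linear_imp_has_derivative in \<open>auto intro: Ck_on_const\<close>)
qed

lemma Ck_on_add: "open S \<Longrightarrow> Ck_on k S f \<Longrightarrow> Ck_on k S g \<Longrightarrow> Ck_on k S (\<lambda>x. f x + g x)"
proof (induction k arbitrary: f g)
  case 0
  then show ?case by (simp add: continuous_on_add)
next
  case (Suc k)
  show ?case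
    by (rule Ck_on_SucI[OF \<open>open S\<close> has_derivative_add[OF Ck_on_SucD(1)[OF Suc.prems(2)] Ck_on_SucD(1)[OF Suc.prems(3)]]])
      (use Suc in auto)
qed

text \<open>By the product rule, with \<open>Ck_on_Suc_imp\<close> lowering the class of the factor
  that is not differentiated. One statement covers scaling, multiplication, inner and cross
  products.\<close>

lemma Ck_on_bilinear:
  assumes "bounded_bilinear (B :: 'b::euclidean_space \<Rightarrow> 'c::euclidean_space \<Rightarrow> 'd::euclidean_space)" "open S"
  shows "Ck_on k S f \<Longrightarrow> Ck_on k S g \<Longrightarrow> Ck_on k S (\<lambda>x. B (f x) (g x))"
proof (induction k arbitrary: f g)
  case 0
  then show ?case
    by (simp add: bounded_bilinear.continuous_on[OF assms(1)])
next
  case (Suc k)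
  have d: "Ck_on k S (\<lambda>x. B (f x) (frechet_derivative g (at x) v) + B (frechet_derivative f (at x) v) (g x))" for v
    using Ck_on_add[OF \<open>open S\<close>
        Suc.IH[OF Ck_on_Suc_imp[OF Suc.prems(1)] Ck_on_SucD(2)[OF Suc.prems(2)]]
        Suc.IH[OF Ck_on_SucD(2)[OF Suc.prems(1)] Ck_on_Suc_imp[OF Suc.prems(2)]]] .
  show ?case
    using Ck_on_SucI[OF \<open>open S\<close> bounded_bilinear.FDERIV[OF assms(1)
          Ck_on_SucD(1)[OF Suc.prems(1)] Ck_on_SucD(1)[OF Suc.prems(2)]] d] .
qed

lemma Ck_on_sum:
  assumes "finite A" "open S" "\<And>i. i \<in> A \<Longrightarrow> Ck_on k S (f i)"
  shows "Ck_on k S (\<lambda>x. \<Sum>i\<in>A. f i x)"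
  using assms by (induction A rule: finite_induct) (auto intro: Ck_on_const Ck_on_add)

lemma Ck_on_compose:
  fixes f :: "'a::euclidean_space \<Rightarrow> 'b::euclidean_space"
  assumes "open S" "open U" "f ` S \<subseteq> U"
  shows "Ck_on k S f \<Longrightarrow> Ck_on k U g \<Longrightarrow> Ck_on k S (\<lambda>x. g (f x))"
proof (induction k arbitrary: g)
  case 0
  then show ?case
    using assms(3) by (auto intro: continuous_on_compose2)
next
  case (Suc k)
  \<comment> \<open>\<open>Ck_on\<close> only controls derivatives in fixed directions, whereas the
    chain rule evaluates the derivative of \<open>g\<close> in the direction
    \<open>frechet_derivative f (at x) v\<close>, which varies with \<open>x\<close>. Expanding this
    direction in \<open>Basis\<close> leaves fixed directions with variable scalar
    coefficients.\<close>
  define F where "F x v = (\<Sum>i\<in>Basis. (frechet_derivative f (at x) v \<bullet> i) *\<^sub>R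
      frechet_derivative g (at (f x)) i)" for x v
  have "((\<lambda>x. g (f x)) has_derivative F x) (at x)" if "x \<in> S" for x
  proof -
    have fx: "f x \<in> U"
      using that assms(3) by auto
    have D: "((\<lambda>x. g (f x)) has_derivative (\<lambda>v. frechet_derivative g (at (f x)) (frechet_derivative f (at x) v))) (at x)"
      by (rule has_derivative_compose[OF Ck_on_SucD(1)[OF Suc.prems(1) that] Ck_on_SucD(1)[OF Suc.prems(2) fx]])
    have lin: "linear (frechet_derivative g (at (f x)))"
      using Ck_on_SucD(1)[OF Suc.prems(2) fx] has_derivative_linear by blast
    have "(\<lambda>v. frechet_derivative g (at (f x)) (frechet_derivative f (at x) v)) = F x"
    proof
      fix v
      have "frechet_derivative g (at (f x)) (\<Sum>i\<in>Basis. (frechet_derivative f (at x) v \<bullet> i) *\<^sub>R i) = F x v"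
        unfolding F_def by (simp add: linear_sum[OF lin] linear_scale[OF lin])
      then show "frechet_derivative g (at (f x)) (frechet_derivative f (at x) v) = F x v"
        by (simp add: euclidean_representation)
    qed
    then show ?thesis
      using D by simp
  qed
  moreover have "Ck_on k S (\<lambda>x. F x v)" for v
  proof -
    have a: "Ck_on k S (\<lambda>x. frechet_derivative f (at x) v \<bullet> i)" for i
      using Ck_on_bilinear[OF bounded_bilinear_inner \<open>open S\<close> Ck_on_SucD(2)[OF Suc.prems(1)]
          Ck_on_const[OF \<open>open S\<close>]] .
    have b: "Ck_on k S (\<lambda>x. frechet_derivative g (at (f x)) i)" for i
      using Suc.IH[OF Ck_on_Suc_imp[OF Suc.prems(1)] Ck_on_SucD(2)[OF Suc.prems(2)]] .
    show ?thesis
      unfolding F_def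
      by (rule Ck_on_sum[OF finite_Basis \<open>open S\<close> Ck_on_bilinear[OF bounded_bilinear_scaleR \<open>open S\<close> a b]])
  qed
  ultimately show ?case
    by (rule Ck_on_SucI[OF \<open>open S\<close>])
qed

section \<open>Smooth maps: closure properties and basic examples\<close>

lemma smooth_on_subset: "smooth_on S f \<Longrightarrow> S' \<subseteq> S \<Longrightarrow> smooth_on S' f"
  unfolding smooth_on_def by (metis Ck_on_subset)

lemma smooth_on_cong: "open S \<Longrightarrow> (\<And>x. x \<in> S \<Longrightarrow> f x = g x) \<Longrightarrow> smooth_on S f \<Longrightarrow> smooth_on S g"
  unfolding smooth_on_def by (metis Ck_on_cong)

lemma smooth_on_const: "open S \<Longrightarrow> smooth_on S (\<lambda>x. c)"
  by (simp add: smooth_on_def Ck_on_const)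

lemma smooth_on_linear: "bounded_linear f \<Longrightarrow> open S \<Longrightarrow> smooth_on S f"
  by (simp add: smooth_on_def Ck_on_linear)

lemma smooth_on_add:
  "open S \<Longrightarrow> smooth_on S f \<Longrightarrow> smooth_on S g \<Longrightarrow> smooth_on S (\<lambda>x. f x + g x)"
  by (simp add: smooth_on_def Ck_on_add)

lemma smooth_on_bilinear:
  "bounded_bilinear B \<Longrightarrow> open S \<Longrightarrow> smooth_on S f \<Longrightarrow> smooth_on S g \<Longrightarrow> smooth_on S (\<lambda>x. B (f x) (g x))"
  for B :: "'b::euclidean_space \<Rightarrow> 'c::euclidean_space \<Rightarrow> 'd::euclidean_space"
  by (simp add: smooth_on_def Ck_on_bilinear)

lemma bounded_bilinear_cross3: "bounded_bilinear cross3"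
  by (simp add: bilinear_conv_bounded_bilinear[symmetric] bilinear_cross)

lemmas smooth_on_scaleR = smooth_on_bilinear[OF bounded_bilinear_scaleR]
  and smooth_on_mult = smooth_on_bilinear[OF bounded_bilinear_mult]
  and smooth_on_inner = smooth_on_bilinear[OF bounded_bilinear_inner]
  and smooth_on_cross3 = smooth_on_bilinear[OF bounded_bilinear_cross3]

lemma smooth_on_compose:
  "open S \<Longrightarrow> open U \<Longrightarrow> f ` S \<subseteq> U \<Longrightarrow> smooth_on S f \<Longrightarrow> smooth_on U g \<Longrightarrow> smooth_on S (\<lambda>x. g (f x))"
  by (simp add: smooth_on_def Ck_on_compose)

text \<open>A pair is the sum of its images under the two linear embeddings of the factors into the
  product.\<close>

lemma smooth_on_Pair:
  fixes f :: "'a::euclidean_space \<Rightarrow> 'b::euclidean_space" and g :: "'a \<Rightarrow> 'c::euclidean_space"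
  assumes "open S" "smooth_on S f" "smooth_on S g"
  shows "smooth_on S (\<lambda>x. (f x, g x))"
proof -
  have l: "bounded_linear (\<lambda>x::'b. (x, 0::'c))" "bounded_linear (\<lambda>x::'c. (0::'b, x))"
    by (auto intro: bounded_linear_Pair bounded_linear_ident bounded_linear_zero)
  have "smooth_on S (\<lambda>x. (f x, 0::'c))" "smooth_on S (\<lambda>x. (0::'b, g x))"
    using smooth_on_compose[OF assms(1) open_UNIV subset_UNIV assms(2) smooth_on_linear[OF l(1) open_UNIV]]
      smooth_on_compose[OF assms(1) open_UNIV subset_UNIV assms(3) smooth_on_linear[OF l(2) open_UNIV]]
    by auto
  from smooth_on_add[OF assms(1) this] show ?thesis by simp
qed

text \<open>The derivative of the inverse is a product of inverses and a constant, so class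
  \<open>k\<close> implies class \<open>k + 1\<close>.\<close>

lemma smooth_on_inverse: "smooth_on (-{0::real}) inverse"
proof -
  have op: "open (-{0::real})" by auto
  have "Ck_on k (-{0::real}) inverse" for k
  proof (induction k)
    case 0
    then show ?case by (auto intro!: continuous_intros)
  next
    case (Suc k)
    have "Ck_on k (-{0::real}) (\<lambda>x. - (inverse x * v * inverse x))" for v
      using Ck_on_bilinear[OF bounded_bilinear_mult op
          Ck_on_bilinear[OF bounded_bilinear_mult op Suc Ck_on_const[OF op, of k "- v"]] Suc]
      by simp
    then show ?case
      by (intro Ck_on_SucI[OF op, where F = "\<lambda>x v. - (inverse x * v * inverse x)"])
        (auto intro: has_derivative_inverse')
  qed
  then show ?thesis by (simp add: smooth_on_def)
qed

text \<open>The derivative is half the inverse of the square root itself, so class \<open>k\<close>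
  passes to class \<open>k + 1\<close> by composition with \<open>smooth_on_inverse\<close>.\<close>

lemma smooth_on_sqrt: "smooth_on {0<..} sqrt"
proof -
  have op: "open {0::real<..}" by auto
  have "Ck_on k {0<..} sqrt" for k
  proof (induction k)
    case 0
    then show ?case by (auto intro!: continuous_intros)
  next
    case (Suc k)
    have "Ck_on k {0<..} (\<lambda>x. inverse (sqrt x))"
      by (rule Ck_on_compose[OF op, of "-{0}" sqrt k inverse])
        (use Suc smooth_on_inverse in \<open>auto simp: smooth_on_def\<close>)
    then have "Ck_on k {0<..} (\<lambda>x. inverse (sqrt x) * (v / 2))" for v
      using Ck_on_bilinear[OF bounded_bilinear_mult op _ Ck_on_const[OF op, of k "v / 2"]] by simp
    moreover have "(sqrt has_derivative (\<lambda>v. inverse (sqrt x) * (v / 2))) (at x)" if "x \<in> {0<..}" for x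
    proof -
      have "(\<lambda>v. inverse (sqrt x) * (v / 2)) = (*) (inverse (sqrt x) / 2)"
        by auto
      then show ?thesis
        using DERIV_real_sqrt[of x] that by (simp only: has_field_derivative_def greaterThan_iff)
    qed
    ultimately show ?case
      by (intro Ck_on_SucI[OF op, where F = "\<lambda>x v. inverse (sqrt x) * (v / 2)"]) auto
  qed
  then show ?thesis by (simp add: smooth_on_def)
qed

lemma smooth_on_norm:
  assumes "open S" "smooth_on S f" "\<And>x. x \<in> S \<Longrightarrow> f x \<noteq> 0"
  shows "smooth_on S (\<lambda>x. norm (f x))"
  unfolding norm_eq_sqrt_inner
  by (rule smooth_on_compose[OF assms(1) _ _ smooth_on_inner[OF assms(1,2,2)] smooth_on_sqrt])
    (use assms(3) in auto)

lemma smooth_on_inverse_compose: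
  assumes "open S" "smooth_on S f" "\<And>x. x \<in> S \<Longrightarrow> f x \<noteq> 0"
  shows "smooth_on S (\<lambda>x. inverse (f x :: real))"
  by (rule smooth_on_compose[OF assms(1) _ _ assms(2) smooth_on_inverse]) (use assms(3) in auto)

lemma smooth_on_imp_continuous_on: "smooth_on S f \<Longrightarrow> continuous_on S f"
  by (simp only: smooth_on_def Ck_on.simps(1)[symmetric])

lemma smooth_on_has_derivative:
  "smooth_on S f \<Longrightarrow> x \<in> S \<Longrightarrow> (f has_derivative frechet_derivative f (at x)) (at x)"
  unfolding smooth_on_def by (rule Ck_on_SucD(1)) simp_all

lemma smooth_on_frechet_derivative:
  "smooth_on S f \<Longrightarrow> smooth_on S (\<lambda>x. frechet_derivative f (at x) v)"
  unfolding smooth_on_def by (auto intro: Ck_on_SucD(2))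

subsection \<open>Mixed partial derivatives\<close>

text \<open>Taken from the total derivative rather than from a slice, so that smoothness is
  inherited through \<open>smooth_on_frechet_derivative\<close>.\<close>

definition partial_u :: "(real \<times> real \<Rightarrow> 'b::euclidean_space) \<Rightarrow> real \<times> real \<Rightarrow> 'b" where
  "partial_u F p = frechet_derivative F (at p) (1, 0)"

definition partial_t :: "(real \<times> real \<Rightarrow> 'b::euclidean_space) \<Rightarrow> real \<times> real \<Rightarrow> 'b" where
  "partial_t F p = frechet_derivative F (at p) (0, 1)"

lemma smooth_on_partial_u: "smooth_on W F \<Longrightarrow> smooth_on W (partial_u F)"
  unfolding partial_u_def[abs_def] by (rule smooth_on_frechet_derivative)

lemma smooth_on_partial_t: "smooth_on W F \<Longrightarrow> smooth_on W (partial_t F)"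
  unfolding partial_t_def[abs_def] by (rule smooth_on_frechet_derivative)

lemma has_vector_derivative_partial_u:
  assumes "smooth_on W F" "(u, t) \<in> W"
  shows "((\<lambda>x. F (x, t)) has_vector_derivative partial_u F (u, t)) (at u)"
proof -
  have D: "(F has_derivative frechet_derivative F (at (u, t))) (at (u, t))"
    by (rule smooth_on_has_derivative[OF assms])
  have "((\<lambda>x. F (x, t)) has_derivative (\<lambda>h. frechet_derivative F (at (u, t)) (h, 0))) (at u)"
    by (rule has_derivative_compose[OF has_derivative_Pair[OF has_derivative_ident has_derivative_const] D])
  moreover have "frechet_derivative F (at (u, t)) (h, 0) = h *\<^sub>R partial_u F (u, t)" for h
    using linear_scale[OF has_derivative_linear[OF D], of h "(1, 0)"] by (simp add: partial_u_def)
  ultimately show ?thesis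
    by (simp add: has_vector_derivative_def)
qed

lemma has_vector_derivative_partial_t:
  assumes "smooth_on W F" "(u, t) \<in> W"
  shows "((\<lambda>r. F (u, r)) has_vector_derivative partial_t F (u, t)) (at t)"
proof -
  have D: "(F has_derivative frechet_derivative F (at (u, t))) (at (u, t))"
    by (rule smooth_on_has_derivative[OF assms])
  have "((\<lambda>r. F (u, r)) has_derivative (\<lambda>h. frechet_derivative F (at (u, t)) (0, h))) (at t)"
    by (rule has_derivative_compose[OF has_derivative_Pair[OF has_derivative_const has_derivative_ident] D])
  moreover have "frechet_derivative F (at (u, t)) (0, h) = h *\<^sub>R partial_t F (u, t)" for h
    using linear_scale[OF has_derivative_linear[OF D], of h "(0, 1)"] by (simp add: partial_t_def)
  ultimately show ?thesis
    by (simp add: has_vector_derivative_def)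
qed

text \<open>The first side is closed, to serve as an interval of integration; the second is an open
  ball, on which one can differentiate in the other variable.\<close>

lemma open_contains_square:
  assumes "open W" "(u :: real, t :: real) \<in> W"
  obtains e where "e > 0" "{u - e..u + e} \<times> ball t e \<subseteq> W"
proof -
  obtain A B where AB: "open A" "open B" "u \<in> A" "t \<in> B" "A \<times> B \<subseteq> W"
    using open_prod_elim[OF assms] by (metis mem_Sigma_iff)
  obtain a b where "a > 0" "cball u a \<subseteq> A" "b > 0" "ball t b \<subseteq> B"
    using AB open_contains_cball open_contains_ball by metis
  moreover have "{u - min a b..u + min a b} \<subseteq> cball u a" "ball t (min a b) \<subseteq> ball t b"
    by (auto simp: dist_real_def abs_le_iff)
  ultimately have "{u - min a b..u + min a b} \<times> ball t (min a b) \<subseteq> A \<times> B"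
    by (meson Sigma_mono order_trans)
  then show thesis
    using that[of "min a b"] \<open>a > 0\<close> \<open>b > 0\<close> AB(5) by simp
qed

text \<open>Differentiating \<open>F(x, r) - F(a, r) = \<integral>\<^sub>a\<^sup>x F\<^sub>u(y, r) dy\<close> first in \<open>r\<close>, under the integral
  sign, and then in \<open>x\<close>.\<close>

lemma partial_t_partial_u_commute:
  assumes W: "open W" and F: "smooth_on W F" and p: "(u, t) \<in> W"
  shows "partial_t (partial_u F) (u, t) = partial_u (partial_t F) (u, t)"
proof -
  obtain e where e: "e > 0" and sub: "{u - e..u + e} \<times> ball t e \<subseteq> W"
    using open_contains_square[OF W p] .
  define G where "G = partial_t (partial_u F)"
  have Gs: "smooth_on W G"
    unfolding G_def by (intro smooth_on_partial_t smooth_on_partial_u F)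
  have int_eq: "integral {u - e..x} (\<lambda>y. G (y, t)) = partial_t F (x, t) - partial_t F (u - e, t)"
    if x: "x \<in> {u - e..u + e}" for x
  proof -
    have ftc: "((\<lambda>y. partial_u F (y, r)) has_integral F (x, r) - F (u - e, r)) {u - e..x}"
      if r: "r \<in> ball t e" for r
    proof (rule fundamental_theorem_of_calculus)
      show "u - e \<le> x" using x by simp
      show "((\<lambda>y. F (y, r)) has_vector_derivative partial_u F (y, r)) (at y within {u - e..x})"
        if "y \<in> {u - e..x}" for y
        by (rule has_vector_derivative_at_within, rule has_vector_derivative_partial_u[OF F])
          (use that x r sub in auto)
    qed
    have "((\<lambda>r. integral (cbox (u - e) x) (\<lambda>y. partial_u F (y, r))) has_vector_derivative
        integral (cbox (u - e) x) (\<lambda>y. G (y, t))) (at t within ball t e)"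
    proof (rule leibniz_rule_vector_derivative)
      fix r y assume "r \<in> ball t e" "y \<in> cbox (u - e) x"
      then have "(y, r) \<in> W" using sub x by auto
      then show "((\<lambda>r. partial_u F (y, r)) has_vector_derivative G (y, r)) (at r within ball t e)"
        unfolding G_def
        by (rule has_vector_derivative_at_within[OF
              has_vector_derivative_partial_t[OF smooth_on_partial_u[OF F]]])
    next
      fix r assume "r \<in> ball t e"
      then show "(\<lambda>y. partial_u F (y, r)) integrable_on cbox (u - e) x"
        using ftc by (auto simp: integrable_on_def)
    next
      show "continuous_on (ball t e \<times> cbox (u - e) x) (\<lambda>(r, y). G (y, r))"
        unfolding case_prod_unfold
        by (rule continuous_on_compose2[OF smooth_on_imp_continuous_on[OF Gs]])
          (use sub x in \<open>auto intro!: continuous_intros\<close>)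
    qed (use e in auto)
    \<comment> \<open>By the fundamental theorem this difference is the same function of
      \<open>r\<close> as the integral just differentiated, so the two derivatives at
      \<open>t\<close> must agree.\<close>
    moreover have "((\<lambda>r. F (x, r) - F (u - e, r)) has_vector_derivative
        partial_t F (x, t) - partial_t F (u - e, t)) (at t within ball t e)"
      by (rule has_vector_derivative_at_within[OF has_vector_derivative_diff[OF
              has_vector_derivative_partial_t[OF F] has_vector_derivative_partial_t[OF F]]])
        (use sub x e in auto)
    then have "((\<lambda>r. integral (cbox (u - e) x) (\<lambda>y. partial_u F (y, r))) has_vector_derivative
        partial_t F (x, t) - partial_t F (u - e, t)) (at t within ball t e)"
      by (rule has_vector_derivative_transform[rotated 2])
        (use e in \<open>auto simp: integral_unique[OF ftc]\<close>)
    ultimately show ?thesis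
      using e by (simp add: at_within_open[of t "ball t e"] vector_derivative_unique_at)
  qed
  \<comment> \<open>Both sides of \<open>int_eq\<close> are now differentiated in \<open>x\<close>
    at the interior point \<open>u\<close>; the interval is nondegenerate, so the derivative within
    it is unique.\<close>
  have "((\<lambda>x. integral {u - e..x} (\<lambda>y. G (y, t))) has_vector_derivative G (u, t))
      (at u within {u - e..u + e})"
  proof (rule integral_has_vector_derivative)
    show "continuous_on {u - e..u + e} (\<lambda>y. G (y, t))"
      by (rule continuous_on_compose2[OF smooth_on_imp_continuous_on[OF Gs]])
        (use sub e in \<open>auto intro!: continuous_intros\<close>)
  qed (use e in auto)
  moreover have "((\<lambda>x. partial_t F (x, t) - partial_t F (u - e, t)) has_vector_derivative
      partial_u (partial_t F) (u, t) - 0) (at u within {u - e..u + e})"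
    by (rule has_vector_derivative_at_within[OF has_vector_derivative_diff[OF
            has_vector_derivative_partial_u[OF smooth_on_partial_t[OF F] p]
            has_vector_derivative_const]])
  then have "((\<lambda>x. integral {u - e..x} (\<lambda>y. G (y, t))) has_vector_derivative
      partial_u (partial_t F) (u, t) - 0) (at u within {u - e..u + e})"
    by (rule has_vector_derivative_transform[rotated 2]) (use e in \<open>auto simp: int_eq\<close>)
  ultimately show ?thesis
    using vector_derivative_unique_within_closed_interval[of "u - e" "u + e" u] e
    unfolding G_def by auto
qed

subsection \<open>The Frenet frame\<close>

abbreviation (input) slice :: "(real \<times> real \<Rightarrow> 'b) \<Rightarrow> real \<Rightarrow> real \<Rightarrow> 'b" where
  "slice F t \<equiv> \<lambda>u. F (u, t)"

context
  fixes W :: "(real \<times> real) set" and F :: "real \<times> real \<Rightarrow> real^3"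
  assumes W: "open W" and F: "smooth_on W F"
begin

lemma speed_slice: "(u, t) \<in> W \<Longrightarrow> speed (slice F t) u = norm (partial_u F (u, t))"
  by (simp add: speed_def vector_derivative_at[OF has_vector_derivative_partial_u[OF F]])

context
  assumes regular: "\<And>p. p \<in> W \<Longrightarrow> partial_u F p \<noteq> 0"
begin

lemma smooth_on_speed: "smooth_on W (\<lambda>(u, t). speed (slice F t) u)"
  by (rule smooth_on_cong[OF W _ smooth_on_norm[OF W smooth_on_partial_u[OF F] regular]])
    (auto simp: speed_slice)

lemma smooth_on_arc_deriv:
  assumes G: "smooth_on W G"
  shows "smooth_on W (\<lambda>(u, t). arc_deriv (slice F t) (slice G t) u)"
proof (rule smooth_on_cong[OF W])
  show "smooth_on W (\<lambda>p. inverse (norm (partial_u F p)) *\<^sub>R partial_u G p)"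
    by (intro smooth_on_scaleR smooth_on_inverse_compose smooth_on_norm smooth_on_partial_u W F G)
      (use regular in auto)
qed (auto simp: arc_deriv_def speed_slice vector_derivative_at[OF has_vector_derivative_partial_u[OF G]])

lemma smooth_on_tangent: "smooth_on W (\<lambda>(u, t). tangent (slice F t) u)"
  unfolding tangent_def by (rule smooth_on_arc_deriv[OF F])

text \<open>Stated before the curvature is assumed positive:
  \<open>curve_family_of_variation\<close> obtains from it the continuity of the curvature at points
  where it may still vanish.\<close>

lemma smooth_on_arc_deriv_tangent:
  "smooth_on W (\<lambda>(u, t). arc_deriv (slice F t) (tangent (slice F t)) u)"
  using smooth_on_arc_deriv[OF smooth_on_tangent] by simp

context
  assumes curved: "\<And>u t. (u, t) \<in> W \<Longrightarrow> curvature (slice F t) u > 0"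
begin

lemma smooth_on_curvature: "smooth_on W (\<lambda>(u, t). curvature (slice F t) u)"
  using smooth_on_norm[OF W smooth_on_arc_deriv_tangent] curved
  by (force simp: curvature_def case_prod_unfold)

lemma smooth_on_normal: "smooth_on W (\<lambda>(u, t). normal (slice F t) u)"
proof -
  have "smooth_on W (\<lambda>p. inverse ((\<lambda>(u, t). curvature (slice F t) u) p) *\<^sub>R
      (\<lambda>(u, t). arc_deriv (slice F t) (tangent (slice F t)) u) p)"
    by (intro smooth_on_scaleR smooth_on_inverse_compose smooth_on_curvature
        smooth_on_arc_deriv_tangent W) (use curved in fastforce)
  then show ?thesis
    by (simp add: normal_def case_prod_unfold)
qed

lemma smooth_on_binormal: "smooth_on W (\<lambda>(u, t). binormal (slice F t) u)"
  using smooth_on_cross3[OF W smooth_on_tangent smooth_on_normal]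
  by (simp add: binormal_def case_prod_unfold)

lemma smooth_on_torsion: "smooth_on W (\<lambda>(u, t). torsion (slice F t) u)"
  using smooth_on_inner[OF W smooth_on_arc_deriv[OF smooth_on_normal] smooth_on_binormal]
  by (simp add: torsion_def case_prod_unfold)

end

end

end

section \<open>Vector calculus and Frenet equations of a single curve\<close>

lemma smooth_on_has_vector_derivative:
  fixes f :: "real \<Rightarrow> 'b::euclidean_space"
  shows "smooth_on S f \<Longrightarrow> x \<in> S \<Longrightarrow> (f has_vector_derivative vector_derivative f (at x)) (at x)"
  using smooth_on_has_derivative differentiableI vector_derivative_works by blast

lemma smooth_on_slice:
  assumes "open I" "open W" "smooth_on W G" "I \<times> {t} \<subseteq> W"
  shows "smooth_on I (slice G t)"
  by (rule smooth_on_compose[where f = "\<lambda>u. (u, t)", OF assms(1,2) _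
        smooth_on_Pair[OF assms(1) smooth_on_linear[OF bounded_linear_ident assms(1)]
          smooth_on_const[OF assms(1)]] assms(3)])
    (use assms(4) in auto)

lemma smooth_on_fst:
  assumes "open I" "open J" "smooth_on I f"
  shows "smooth_on (I \<times> J) (\<lambda>p. f (fst p))"
  by (rule smooth_on_compose[OF open_Times[OF assms(1,2)] assms(1) _
        smooth_on_linear[OF bounded_linear_fst open_Times[OF assms(1,2)]] assms(3)]) auto

text \<open>The difference \<open>y\<close> of the two sides is orthogonal to T, N and B. As B is
  the cross product of T and N, the triple product expansion makes the cross product of
  \<open>y\<close> and B vanish too, and a vector both orthogonal and parallel to a unit vector is
  zero.\<close>

lemma orthonormal_expansion:
  fixes T N x :: "real^3"
  assumes "T \<bullet> T = 1" "N \<bullet> N = 1" "T \<bullet> N = 0"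
  shows "x = (x \<bullet> T) *\<^sub>R T + (x \<bullet> N) *\<^sub>R N + (x \<bullet> cross3 T N) *\<^sub>R cross3 T N"
proof -
  define B where "B = cross3 T N"
  have B: "B \<bullet> B = 1" "T \<bullet> B = 0" "N \<bullet> B = 0"
    using assms by (simp_all add: B_def dot_cross dot_cross_self inner_commute)
  define y where "y = x - ((x \<bullet> T) *\<^sub>R T + (x \<bullet> N) *\<^sub>R N + (x \<bullet> B) *\<^sub>R B)"
  have y: "y \<bullet> T = 0" "y \<bullet> N = 0" "y \<bullet> B = 0"
    using assms B by (simp_all add: y_def inner_diff_left inner_add_left inner_commute[of N T]
        inner_commute[of B T] inner_commute[of B N])
  have "cross3 y B = (y \<bullet> N) *\<^sub>R T - (y \<bullet> T) *\<^sub>R N"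
    unfolding B_def Lagrange by (simp add: inner_commute)
  then have "y \<bullet> B = 0 \<and> cross3 y B = 0"
    using y by simp
  then have "y = 0"
    using B(1) norm_and_cross_eq_0[of y B] by auto
  then show ?thesis
    by (simp add: y_def B_def)
qed

text \<open>The product rule applied to a constant inner product; it yields the skew symmetry of the
  Frenet equations.\<close>

lemma has_vector_derivative_inner_constant:
  fixes f g :: "real \<Rightarrow> real^3"
  assumes "open I" "u \<in> I" "(f has_vector_derivative f') (at u)" "(g has_vector_derivative g') (at u)"
    and "\<And>x. x \<in> I \<Longrightarrow> f x \<bullet> g x = c"
  shows "f u \<bullet> g' + f' \<bullet> g u = 0"
proof -
  have "((\<lambda>x. f x \<bullet> g x) has_vector_derivative f u \<bullet> g' + f' \<bullet> g u) (at u)"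
    by (rule bounded_bilinear.has_vector_derivative[OF bounded_bilinear_inner assms(3,4)])
  moreover have "((\<lambda>x. f x \<bullet> g x) has_vector_derivative 0) (at u)"
    by (rule has_vector_derivative_transform_within_open[OF has_vector_derivative_const[of c] assms(1,2)])
      (simp add: assms(5))
  ultimately show ?thesis
    using vector_derivative_unique_at by blast
qed

text \<open>Leaves out the sign of the torsion, so that the Frenet equations are available for an
  explicit curve whose torsion is yet to be computed.\<close>

definition frenet_curve :: "real set \<Rightarrow> (real \<Rightarrow> real^3) \<Rightarrow> bool" where
  "frenet_curve I \<gamma> \<longleftrightarrow> open I \<and> smooth_on I \<gamma> \<and>
    (\<forall>u\<in>I. vector_derivative \<gamma> (at u) \<noteq> 0 \<and> curvature \<gamma> u > 0)"

lemma positive_torsion_curve_imp_frenet_curve: "positive_torsion_curve I \<gamma> \<Longrightarrow> frenet_curve I \<gamma>"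
  by (simp add: positive_torsion_curve_def frenet_curve_def)

context
  fixes I :: "real set" and \<gamma> :: "real \<Rightarrow> real^3"
  assumes \<gamma>: "frenet_curve I \<gamma>"
begin

text \<open>The curve is viewed as a family that is constant in time, to which the joint smoothness
  results apply; a slice then gives smoothness in the parameter.\<close>

lemma frenet_curve_smooth:
  shows "smooth_on I (tangent \<gamma>)" "smooth_on I (normal \<gamma>)" "smooth_on I (binormal \<gamma>)"
    "smooth_on I (curvature \<gamma>)" "smooth_on I (torsion \<gamma>)" "smooth_on I (speed \<gamma>)"
proof -
  define F where "F = (\<lambda>p::real \<times> real. \<gamma> (fst p))"
  define W where "W = I \<times> (UNIV :: real set)"
  have I: "open I" and s: "smooth_on I \<gamma>"
    using \<gamma> by (auto simp: frenet_curve_def)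
  have W: "open W"
    using I by (auto simp: W_def intro: open_Times)
  have F: "smooth_on W F"
    unfolding F_def W_def by (rule smooth_on_fst[OF I open_UNIV s])
  have sl: "slice F t = \<gamma>" for t
    by (simp add: F_def)
  have reg: "partial_u F p \<noteq> 0" if "p \<in> W" for p
  proof -
    obtain u t where p: "p = (u, t)" by (cases p)
    have "vector_derivative \<gamma> (at u) = partial_u F (u, t)"
      using vector_derivative_at[OF has_vector_derivative_partial_u[OF F, of u t]] that p sl by simp
    moreover have "vector_derivative \<gamma> (at u) \<noteq> 0"
      using that p \<gamma> by (auto simp: frenet_curve_def W_def)
    ultimately show ?thesis using p by simp
  qed
  have cur: "curvature (slice F t) u > 0" if "(u, t) \<in> W" for u t
    using that \<gamma> by (auto simp: frenet_curve_def W_def sl)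
  have sub: "I \<times> {0} \<subseteq> W" by (auto simp: W_def)
  show "smooth_on I (tangent \<gamma>)"
    using smooth_on_slice[OF I W smooth_on_tangent[OF W F reg] sub] by (simp add: sl)
  show "smooth_on I (normal \<gamma>)"
    using smooth_on_slice[OF I W smooth_on_normal[OF W F reg cur] sub] by (simp add: sl)
  show "smooth_on I (binormal \<gamma>)"
    using smooth_on_slice[OF I W smooth_on_binormal[OF W F reg cur] sub] by (simp add: sl)
  show "smooth_on I (curvature \<gamma>)"
    using smooth_on_slice[OF I W smooth_on_curvature[OF W F reg cur] sub] by (simp add: sl)
  show "smooth_on I (torsion \<gamma>)"
    using smooth_on_slice[OF I W smooth_on_torsion[OF W F reg cur] sub] by (simp add: sl)
  show "smooth_on I (speed \<gamma>)"
    using smooth_on_slice[OF I W smooth_on_speed[OF W F reg] sub] by (simp add: sl)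
qed

lemma frenet_curve_pos:
  assumes "u \<in> I"
  shows "speed \<gamma> u > 0" "curvature \<gamma> u > 0"
  using \<gamma> assms by (auto simp: frenet_curve_def speed_def)

text \<open>The first Frenet equation, immediate from the definition of N; the speed appears because
  \<open>u\<close> is an arbitrary parameter.\<close>

lemma has_vector_derivative_tangent:
  assumes "u \<in> I"
  shows "(tangent \<gamma> has_vector_derivative (speed \<gamma> u * curvature \<gamma> u) *\<^sub>R normal \<gamma> u) (at u)"
proof -
  have "(speed \<gamma> u * curvature \<gamma> u) *\<^sub>R normal \<gamma> u = vector_derivative (tangent \<gamma>) (at u)"
    using frenet_curve_pos[OF assms] by (simp add: normal_def arc_deriv_def field_simps)
  then show ?thesis
    using smooth_on_has_vector_derivative[OF frenet_curve_smooth(1) assms] by simp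
qed

lemma tangent_inner_tangent:
  assumes "u \<in> I"
  shows "tangent \<gamma> u \<bullet> tangent \<gamma> u = 1"
  using frenet_curve_pos(1)[OF assms]
  by (simp add: dot_square_norm tangent_def arc_deriv_def speed_def)

lemma normal_inner_normal:
  assumes "u \<in> I"
  shows "normal \<gamma> u \<bullet> normal \<gamma> u = 1"
  using frenet_curve_pos(2)[OF assms]
  by (simp add: dot_square_norm normal_def curvature_def)

lemma frenet_curve_open: "open I"
  using \<gamma> by (simp add: frenet_curve_def)

lemma tangent_inner_normal:
  assumes "u \<in> I"
  shows "tangent \<gamma> u \<bullet> normal \<gamma> u = 0"
proof -
  have "tangent \<gamma> u \<bullet> ((speed \<gamma> u * curvature \<gamma> u) *\<^sub>R normal \<gamma> u)
      + ((speed \<gamma> u * curvature \<gamma> u) *\<^sub>R normal \<gamma> u) \<bullet> tangent \<gamma> u = 0"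
    by (rule has_vector_derivative_inner_constant[OF frenet_curve_open assms
        has_vector_derivative_tangent[OF assms] has_vector_derivative_tangent[OF assms]
        tangent_inner_tangent])
  then have "2 * (speed \<gamma> u * curvature \<gamma> u) * (tangent \<gamma> u \<bullet> normal \<gamma> u) = 0"
    by (simp add: inner_commute algebra_simps)
  then show ?thesis
    using frenet_curve_pos[OF assms] by auto
qed

text \<open>The derivative is expanded in the frame: its N-component vanishes since N has unit
  length, its T-component comes from differentiating the orthogonality of T and N, and its
  B-component is the definition of the torsion.\<close>

lemma has_vector_derivative_normal:
  assumes "u \<in> I"
  shows "(normal \<gamma> has_vector_derivative
    speed \<gamma> u *\<^sub>R (torsion \<gamma> u *\<^sub>R binormal \<gamma> u - curvature \<gamma> u *\<^sub>R tangent \<gamma> u)) (at u)"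
proof -
  define n where "n = vector_derivative (normal \<gamma>) (at u)"
  have n: "(normal \<gamma> has_vector_derivative n) (at u)"
    unfolding n_def by (rule smooth_on_has_vector_derivative[OF frenet_curve_smooth(2) assms])
  have nN: "n \<bullet> normal \<gamma> u = 0"
    using has_vector_derivative_inner_constant[OF frenet_curve_open assms n n normal_inner_normal]
    by (simp add: inner_commute)
  have nT: "n \<bullet> tangent \<gamma> u = - (speed \<gamma> u * curvature \<gamma> u)"
    using has_vector_derivative_inner_constant[OF frenet_curve_open assms
        has_vector_derivative_tangent[OF assms] n tangent_inner_normal]
    by (simp add: inner_commute normal_inner_normal[OF assms])
  have nB: "n \<bullet> binormal \<gamma> u = speed \<gamma> u * torsion \<gamma> u"
    using frenet_curve_pos(1)[OF assms] by (simp add: torsion_def arc_deriv_def n_def)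
  have "n = (n \<bullet> tangent \<gamma> u) *\<^sub>R tangent \<gamma> u + (n \<bullet> normal \<gamma> u) *\<^sub>R normal \<gamma> u
      + (n \<bullet> binormal \<gamma> u) *\<^sub>R binormal \<gamma> u"
    unfolding binormal_def
    by (rule orthonormal_expansion)
      (use assms tangent_inner_tangent normal_inner_normal tangent_inner_normal in auto)
  then have "n = speed \<gamma> u *\<^sub>R (torsion \<gamma> u *\<^sub>R binormal \<gamma> u - curvature \<gamma> u *\<^sub>R tangent \<gamma> u)"
    unfolding nN nT nB by (simp add: algebra_simps)
  then show ?thesis using n by simp
qed

text \<open>The product rule on the cross product of T and N: the N-terms cancel as N is parallel to
  itself, the T-terms likewise, and the cross product of T and B is -N.\<close>

lemma has_vector_derivative_binormal:
  assumes "u \<in> I"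
  shows "(binormal \<gamma> has_vector_derivative - (speed \<gamma> u * torsion \<gamma> u) *\<^sub>R normal \<gamma> u) (at u)"
proof -
  have "cross3 (tangent \<gamma> u) (binormal \<gamma> u) = - normal \<gamma> u"
    unfolding binormal_def Lagrange
    by (simp add: tangent_inner_normal[OF assms] tangent_inner_tangent[OF assms])
  moreover have "(binormal \<gamma> has_vector_derivative
     cross3 (tangent \<gamma> u) (speed \<gamma> u *\<^sub>R (torsion \<gamma> u *\<^sub>R binormal \<gamma> u - curvature \<gamma> u *\<^sub>R tangent \<gamma> u))
     + cross3 ((speed \<gamma> u * curvature \<gamma> u) *\<^sub>R normal \<gamma> u) (normal \<gamma> u)) (at u)"
    unfolding binormal_def[abs_def]
    by (rule bounded_bilinear.has_vector_derivative[OF bounded_bilinear_cross3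
          has_vector_derivative_tangent[OF assms] has_vector_derivative_normal[OF assms, unfolded binormal_def]])
  ultimately show ?thesis
    by (simp add: cross_mult_left cross_mult_right Cross3.right_diff_distrib)
qed

end

subsection \<open>Evolution of speed and curvature\<close>

lemma has_vector_derivative_frame:
  assumes \<gamma>: "frenet_curve I \<gamma>" and u: "u \<in> I"
    and a: "(a has_vector_derivative a') (at u)" and b: "(b has_vector_derivative b') (at u)"
    and c: "(c has_vector_derivative c') (at u)"
  shows "((\<lambda>x. a x *\<^sub>R tangent \<gamma> x + b x *\<^sub>R normal \<gamma> x + c x *\<^sub>R binormal \<gamma> x) has_vector_derivative
    (a' - speed \<gamma> u * curvature \<gamma> u * b u) *\<^sub>R tangent \<gamma> u
    + (b' + speed \<gamma> u * curvature \<gamma> u * a u - speed \<gamma> u * torsion \<gamma> u * c u) *\<^sub>R normal \<gamma> u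
    + (c' + speed \<gamma> u * torsion \<gamma> u * b u) *\<^sub>R binormal \<gamma> u) (at u)"
proof (rule has_vector_derivative_eq_rhs)
  note sc = bounded_bilinear.has_vector_derivative[OF bounded_bilinear_scaleR]
  show "((\<lambda>x. a x *\<^sub>R tangent \<gamma> x + b x *\<^sub>R normal \<gamma> x + c x *\<^sub>R binormal \<gamma> x) has_vector_derivative
    (a u *\<^sub>R ((speed \<gamma> u * curvature \<gamma> u) *\<^sub>R normal \<gamma> u) + a' *\<^sub>R tangent \<gamma> u)
    + (b u *\<^sub>R (speed \<gamma> u *\<^sub>R (torsion \<gamma> u *\<^sub>R binormal \<gamma> u - curvature \<gamma> u *\<^sub>R tangent \<gamma> u)) + b' *\<^sub>R normal \<gamma> u)
    + (c u *\<^sub>R (- (speed \<gamma> u * torsion \<gamma> u) *\<^sub>R normal \<gamma> u) + c' *\<^sub>R binormal \<gamma> u)) (at u)"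
    by (intro has_vector_derivative_add sc a b c has_vector_derivative_tangent[OF \<gamma> u]
        has_vector_derivative_normal[OF \<gamma> u] has_vector_derivative_binormal[OF \<gamma> u])
qed (simp add: algebra_simps)

lemma frame_inner:
  assumes "frenet_curve I \<gamma>" "u \<in> I"
  shows "tangent \<gamma> u \<bullet> (a *\<^sub>R tangent \<gamma> u + b *\<^sub>R normal \<gamma> u + c *\<^sub>R binormal \<gamma> u) = a"
    and "normal \<gamma> u \<bullet> (a *\<^sub>R tangent \<gamma> u + b *\<^sub>R normal \<gamma> u + c *\<^sub>R binormal \<gamma> u) = b"
  using tangent_inner_tangent[OF assms] normal_inner_normal[OF assms] tangent_inner_normal[OF assms]
  by (simp_all add: inner_add_right binormal_def dot_cross_self inner_commute[of "normal \<gamma> u" "tangent \<gamma> u"])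

section \<open>First variation of length, speed and curvature\<close>

context
  fixes I J :: "real set" and X :: "real \<Rightarrow> real \<Rightarrow> real^3" and F S K :: "real \<times> real \<Rightarrow> _"
    and V :: "real \<Rightarrow> real^3" and t :: real
  assumes fam: "curve_family I J X" and t: "t \<in> J"
  defines "F \<equiv> \<lambda>(u, t). X u t"
    and "S \<equiv> \<lambda>(u, t). speed (\<lambda>x. X x t) u"
    and "K \<equiv> \<lambda>(u, t). curvature (\<lambda>x. X x t) u"
    and "V \<equiv> \<lambda>u. vector_derivative (X u) (at t)"
begin

lemma family_open: "open (I \<times> J)" "open I" "open J" "is_interval I" "is_interval J"
  using fam t by (auto simp: curve_family_def positive_torsion_curve_def intro: open_Times)

lemma family_curve: "r \<in> J \<Longrightarrow> frenet_curve I (\<lambda>u. X u r)"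
  using fam by (simp add: curve_family_def positive_torsion_curve_imp_frenet_curve)

lemma family_smooth: "smooth_on (I \<times> J) F"
  using fam by (simp add: F_def curve_family_def)

lemma family_slice: "slice F r = (\<lambda>u. X u r)"
  by (simp add: F_def)

lemma family_regular: "p \<in> I \<times> J \<Longrightarrow> partial_u F p \<noteq> 0"
proof -
  assume "p \<in> I \<times> J"
  then obtain u r where p: "p = (u, r)" "u \<in> I" "r \<in> J" by auto
  then show ?thesis
    using speed_slice[OF family_open(1) family_smooth, of u r]
      frenet_curve_pos(1)[OF family_curve, of r u] by (auto simp: family_slice)
qed

lemma family_curved: "(u, r) \<in> I \<times> J \<Longrightarrow> curvature (slice F r) u > 0"
  using frenet_curve_pos(2)[OF family_curve] by (simp add: family_slice)

lemma family_speed_smooth: "smooth_on (I \<times> J) S"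
  using smooth_on_speed[OF family_open(1) family_smooth family_regular] by (simp add: S_def family_slice)

lemma family_curvature_smooth: "smooth_on (I \<times> J) K"
  using smooth_on_curvature[OF family_open(1) family_smooth family_regular family_curved]
  by (simp add: K_def family_slice)

text \<open>Differentiation under the integral sign; \<open>I\<close> is an interval, so the range
  of integration stays inside the domain of the family.\<close>

lemma arc_length_has_derivative:
  assumes ab: "a \<in> I" "b \<in> I"
  shows "((\<lambda>r. arc_length (\<lambda>u. X u r) a b) has_real_derivative
    integral {a..b} (\<lambda>u. partial_t S (u, t))) (at t)"
proof -
  have sub: "{a..b} \<subseteq> I"
    using family_open(4) ab by (meson atLeastAtMost_iff mem_is_interval_1_I subsetI)
  have "((\<lambda>r. integral (cbox a b) (\<lambda>u. S (u, r))) has_real_derivative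
      integral (cbox a b) (\<lambda>u. partial_t S (u, t))) (at t within J)"
  proof (rule leibniz_rule_field_derivative)
    fix r u assume "r \<in> J" "u \<in> cbox a b"
    then have "(u, r) \<in> I \<times> J" using sub by auto
    from has_vector_derivative_partial_t[OF family_speed_smooth this]
    show "((\<lambda>r. S (u, r)) has_real_derivative partial_t S (u, r)) (at r within J)"
      by (auto simp: has_real_derivative_iff_has_vector_derivative intro: has_vector_derivative_at_within)
  next
    fix r assume "r \<in> J"
    then show "(\<lambda>u. S (u, r)) integrable_on cbox a b"
      using sub
      by (intro integrable_continuous continuous_on_compose2[OF smooth_on_imp_continuous_on[OF family_speed_smooth]])
        (auto intro!: continuous_intros)
  next
    show "continuous_on (J \<times> cbox a b) (\<lambda>(r, u). partial_t S (u, r))"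
      unfolding case_prod_unfold
      by (rule continuous_on_compose2[OF smooth_on_imp_continuous_on[OF smooth_on_partial_t[OF family_speed_smooth]]])
        (use sub in \<open>auto intro!: continuous_intros\<close>)
  qed (use t family_open(5) is_interval_convex in auto)
  then show ?thesis
    using at_within_open[OF t family_open(3)] by (simp add: arc_length_def S_def)
qed

text \<open>If all lengths are stationary, the integral of \<open>partial_t S\<close> from
  \<open>a\<close> to \<open>x\<close> vanishes for every \<open>x\<close> slightly beyond
  \<open>a\<close>; its one-sided derivative at \<open>a\<close>, which is the integrand there, is
  therefore zero. The other direction integrates zero.\<close>

lemma arc_length_stationary_iff:
  "(\<forall>a\<in>I. \<forall>b\<in>I. a \<le> b \<longrightarrow> ((\<lambda>r. arc_length (\<lambda>u. X u r) a b) has_real_derivative 0) (at t))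
    \<longleftrightarrow> (\<forall>u\<in>I. partial_t S (u, t) = 0)"
proof
  assume "\<forall>u\<in>I. partial_t S (u, t) = 0"
  then have "integral {a..b} (\<lambda>u. partial_t S (u, t)) = integral {a..b} (\<lambda>u. 0)" if "a \<in> I" "b \<in> I" for a b
    using family_open(4) that by (intro integral_cong) (meson atLeastAtMost_iff mem_is_interval_1_I)
  then show "\<forall>a\<in>I. \<forall>b\<in>I. a \<le> b \<longrightarrow>
      ((\<lambda>r. arc_length (\<lambda>u. X u r) a b) has_real_derivative 0) (at t)"
    using arc_length_has_derivative by simp
next
  assume L: "\<forall>a\<in>I. \<forall>b\<in>I. a \<le> b \<longrightarrow>
      ((\<lambda>r. arc_length (\<lambda>u. X u r) a b) has_real_derivative 0) (at t)"
  show "\<forall>u\<in>I. partial_t S (u, t) = 0"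
  proof
    fix a assume a: "a \<in> I"
    then obtain e where e: "e > 0" "cball a e \<subseteq> I"
      using family_open(2) open_contains_cball by blast
    define g where "g u = partial_t S (u, t)" for u
    have sub: "{a..a + e} \<subseteq> I"
      using e by (auto simp: dist_real_def subset_iff)
    have zero: "integral {a..x} g = 0" if "x \<in> {a..a + e}" for x
    proof -
      have x: "x \<in> I" "a \<le> x" using sub that by auto
      show ?thesis
        unfolding g_def
        by (rule DERIV_unique[OF arc_length_has_derivative[OF a x(1)]]) (use L a x in simp)
    qed
    have "continuous_on {a..a + e} g"
      unfolding g_def
      by (rule continuous_on_compose2[OF smooth_on_imp_continuous_on[OF smooth_on_partial_t[OF family_speed_smooth]]])
        (use sub t in \<open>auto intro!: continuous_intros\<close>)
    then have "((\<lambda>x. integral {a..x} g) has_vector_derivative g a) (at a within {a..a + e})"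
      by (rule integral_has_vector_derivative) (use e in auto)
    moreover have "((\<lambda>x. integral {a..x} g) has_vector_derivative 0) (at a within {a..a + e})"
      by (rule has_vector_derivative_transform[OF _ _ has_vector_derivative_const[of 0]]) (use e zero in auto)
    ultimately show "partial_t S (a, t) = 0"
      using vector_derivative_unique_within_closed_interval[of a "a + e" a] e
      unfolding g_def by auto
  qed
qed

lemma velocity_eq_partial_t: "u \<in> I \<Longrightarrow> V u = partial_t F (u, t)"
  using vector_derivative_at[OF has_vector_derivative_partial_t[OF family_smooth, of u t]] t
  by (simp add: V_def F_def)

text \<open>This is where the exchange of the time and parameter derivatives enters: the velocity is
  \<open>partial_t F\<close>, so its derivative along the curve is the time derivative of
  \<open>partial_u F\<close>.\<close>

lemma has_vector_derivative_velocity: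
  assumes u: "u \<in> I"
  shows "(V has_vector_derivative partial_t (partial_u F) (u, t)) (at u)"
proof -
  have p: "(u, t) \<in> I \<times> J" using u t by simp
  show ?thesis
    unfolding partial_t_partial_u_commute[OF family_open(1) family_smooth p]
    by (rule has_vector_derivative_transform_within_open[OF
          has_vector_derivative_partial_u[OF smooth_on_partial_t[OF family_smooth] p] family_open(2) u])
      (simp add: velocity_eq_partial_t)
qed

lemma partial_u_eq_speed_tangent:
  "u \<in> I \<Longrightarrow> r \<in> J \<Longrightarrow> partial_u F (u, r) = S (u, r) *\<^sub>R tangent (\<lambda>x. X x r) u"
  using vector_derivative_at[OF has_vector_derivative_partial_u[OF family_smooth, of u r]]
    frenet_curve_pos(1)[OF family_curve, of r u]
  by (simp add: tangent_def arc_deriv_def S_def family_slice)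

text \<open>Differentiating the squared speed in time and dividing by the speed, which is positive,
  avoids differentiating a norm.\<close>

lemma partial_t_speed:
  assumes u: "u \<in> I"
  shows "partial_t S (u, t) = tangent (\<lambda>x. X x t) u \<bullet> partial_t (partial_u F) (u, t)"
proof -
  have p: "(u, t) \<in> I \<times> J" using u t by simp
  have S: "S (u, r) * S (u, r) = partial_u F (u, r) \<bullet> partial_u F (u, r)" if "r \<in> J" for r
    using u that partial_u_eq_speed_tangent tangent_inner_tangent[OF family_curve] by simp
  note d = has_vector_derivative_partial_t[OF family_speed_smooth p]
    and e = has_vector_derivative_partial_t[OF smooth_on_partial_u[OF family_smooth] p]
  have "((\<lambda>r. S (u, r) * S (u, r)) has_vector_derivative
      S (u, t) * partial_t S (u, t) + partial_t S (u, t) * S (u, t)) (at t)"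
    by (rule bounded_bilinear.has_vector_derivative[OF bounded_bilinear_mult d d])
  moreover have "((\<lambda>r. S (u, r) * S (u, r)) has_vector_derivative
      partial_u F (u, t) \<bullet> partial_t (partial_u F) (u, t) + partial_t (partial_u F) (u, t) \<bullet> partial_u F (u, t)) (at t)"
    by (rule has_vector_derivative_transform_within_open[OF
          bounded_bilinear.has_vector_derivative[OF bounded_bilinear_inner e e] family_open(3) t])
      (simp add: S)
  ultimately have "S (u, t) * partial_t S (u, t) + partial_t S (u, t) * S (u, t) =
      partial_u F (u, t) \<bullet> partial_t (partial_u F) (u, t) + partial_t (partial_u F) (u, t) \<bullet> partial_u F (u, t)"
    by (rule vector_derivative_unique_at)
  then have "S (u, t) * partial_t S (u, t) = partial_u F (u, t) \<bullet> partial_t (partial_u F) (u, t)"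
    by (simp add: inner_commute mult.commute)
  then show ?thesis
    using frenet_curve_pos(1)[OF family_curve[OF t] u] u t
    by (simp add: partial_u_eq_speed_tangent S_def)
qed

text \<open>When the speed is stationary along the whole curve, the time derivative of T is
  \<open>partial_t (partial_u F)\<close> divided by the speed, so \<open>D\<close> is the mixed
  second derivative of T. Differentiating the squared length of \<open>partial_u T\<close>, which is
  the square of speed times curvature, then gives the result.\<close>

lemma curvature_has_derivative:
  assumes stat: "\<And>u. u \<in> I \<Longrightarrow> partial_t S (u, t) = 0" and u: "u \<in> I"
    and D: "((\<lambda>x. partial_t (partial_u F) (x, t) /\<^sub>R S (x, t)) has_vector_derivative D) (at u)"
  shows "((\<lambda>r. curvature (\<lambda>x. X x r) u) has_real_derivative (normal (\<lambda>x. X x t) u \<bullet> D) / S (u, t)) (at t)"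
proof -
  define T where "T = (\<lambda>(u, t). tangent (\<lambda>x. X x t) u)"
  have T: "smooth_on (I \<times> J) T"
    using smooth_on_tangent[OF family_open(1) family_smooth family_regular] by (simp add: T_def family_slice)
  have p: "(x, t) \<in> I \<times> J" if "x \<in> I" for x using that t by simp
  have pos: "S (x, t) > 0" "K (x, t) > 0" if "x \<in> I" for x
    using frenet_curve_pos(1,2)[OF family_curve[OF t] that] by (simp_all add: S_def K_def)
  \<comment> \<open>Compare the product rule for speed times T with the time derivative of
    \<open>partial_u F\<close>. The formula is needed at all points of \<open>I\<close>, since it is
    differentiated along the curve next.\<close>
  have Tt: "partial_t T (x, t) = partial_t (partial_u F) (x, t) /\<^sub>R S (x, t)" if x: "x \<in> I" for x
  proof -
    have "((\<lambda>r. S (x, r) *\<^sub>R T (x, r)) has_vector_derivative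
        S (x, t) *\<^sub>R partial_t T (x, t) + partial_t S (x, t) *\<^sub>R T (x, t)) (at t)"
      by (rule bounded_bilinear.has_vector_derivative[OF bounded_bilinear_scaleR
            has_vector_derivative_partial_t[OF family_speed_smooth p[OF x]]
            has_vector_derivative_partial_t[OF T p[OF x]]])
    moreover have "((\<lambda>r. S (x, r) *\<^sub>R T (x, r)) has_vector_derivative partial_t (partial_u F) (x, t)) (at t)"
      by (rule has_vector_derivative_transform_within_open[OF
            has_vector_derivative_partial_t[OF smooth_on_partial_u[OF family_smooth] p[OF x]] family_open(3) t])
        (simp add: partial_u_eq_speed_tangent x T_def)
    ultimately have "S (x, t) *\<^sub>R partial_t T (x, t) + partial_t S (x, t) *\<^sub>R T (x, t) =
        partial_t (partial_u F) (x, t)"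
      by (rule vector_derivative_unique_at)
    then have "partial_t (partial_u F) (x, t) = S (x, t) *\<^sub>R partial_t T (x, t)"
      by (simp add: stat[OF x])
    then show ?thesis
      using pos[OF x] by simp
  qed
  have "((\<lambda>x. partial_t T (x, t)) has_vector_derivative D) (at u)"
    by (rule has_vector_derivative_transform_within_open[OF D family_open(2) u]) (simp add: Tt)
  \<comment> \<open>The exchange of partial derivatives is used a second time, now for T.\<close>
  then have Ttu: "partial_t (partial_u T) (u, t) = D"
    unfolding partial_t_partial_u_commute[OF family_open(1) T p[OF u]]
    by (rule vector_derivative_unique_at[OF
          has_vector_derivative_partial_u[OF smooth_on_partial_t[OF T] p[OF u]]])
  have Tu: "partial_u T (u, r) = (S (u, r) * K (u, r)) *\<^sub>R normal (\<lambda>x. X x r) u" if r: "r \<in> J" for r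
  proof -
    have "(tangent (\<lambda>x. X x r) has_vector_derivative partial_u T (u, r)) (at u)"
      using has_vector_derivative_partial_u[OF T, of u r] u r by (simp add: T_def)
    from vector_derivative_unique_at[OF this has_vector_derivative_tangent[OF family_curve[OF r] u]]
    show ?thesis by (simp add: S_def K_def)
  qed
  \<comment> \<open>As for the speed, squares are differentiated; the positive factor
    \<open>S * K\<close> is cancelled at the end.\<close>
  have SK: "(S (u, r) * K (u, r)) * (S (u, r) * K (u, r)) = partial_u T (u, r) \<bullet> partial_u T (u, r)"
    if r: "r \<in> J" for r
    using normal_inner_normal[OF family_curve[OF r] u] by (simp add: Tu[OF r])
  note e = has_vector_derivative_partial_t[OF smooth_on_partial_u[OF T] p[OF u]]
  have d: "((\<lambda>r. S (u, r) * K (u, r)) has_vector_derivative S (u, t) * partial_t K (u, t)) (at t)"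
    using bounded_bilinear.has_vector_derivative[OF bounded_bilinear_mult
        has_vector_derivative_partial_t[OF family_speed_smooth p[OF u]]
        has_vector_derivative_partial_t[OF family_curvature_smooth p[OF u]]] stat[OF u]
    by simp
  have "((\<lambda>r. (S (u, r) * K (u, r)) * (S (u, r) * K (u, r))) has_vector_derivative
      (S (u, t) * K (u, t)) * (S (u, t) * partial_t K (u, t))
      + (S (u, t) * partial_t K (u, t)) * (S (u, t) * K (u, t))) (at t)"
    by (rule bounded_bilinear.has_vector_derivative[OF bounded_bilinear_mult d d])
  moreover have "((\<lambda>r. (S (u, r) * K (u, r)) * (S (u, r) * K (u, r))) has_vector_derivative
      partial_u T (u, t) \<bullet> D + D \<bullet> partial_u T (u, t)) (at t)"
    by (rule has_vector_derivative_transform_within_open[OF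
          bounded_bilinear.has_vector_derivative[OF bounded_bilinear_inner e e, unfolded Ttu] family_open(3) t])
      (simp add: SK)
  ultimately have "(S (u, t) * K (u, t)) * (S (u, t) * partial_t K (u, t))
      + (S (u, t) * partial_t K (u, t)) * (S (u, t) * K (u, t)) = partial_u T (u, t) \<bullet> D + D \<bullet> partial_u T (u, t)"
    by (rule vector_derivative_unique_at)
  also have "\<dots> = 2 * (S (u, t) * K (u, t)) * (normal (\<lambda>x. X x t) u \<bullet> D)"
    by (simp add: Tu[OF t] inner_commute)
  finally have "2 * (S (u, t) * K (u, t)) * (S (u, t) * partial_t K (u, t)) =
      2 * (S (u, t) * K (u, t)) * (normal (\<lambda>x. X x t) u \<bullet> D)"
    by (simp add: mult.commute)
  then have "S (u, t) * partial_t K (u, t) = normal (\<lambda>x. X x t) u \<bullet> D"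
    using pos[OF u] by simp
  then have "partial_t K (u, t) = (normal (\<lambda>x. X x t) u \<bullet> D) / S (u, t)"
    using pos(1)[OF u] by (simp add: field_simps)
  then show ?thesis
    using has_vector_derivative_partial_t[OF family_curvature_smooth p[OF u]]
    by (simp add: has_real_derivative_iff_has_vector_derivative K_def)
qed

section \<open>Velocities written in the Frenet frame\<close>

context
  fixes a b c :: "real \<Rightarrow> real"
  assumes a: "smooth_on I a" and b: "smooth_on I b" and c: "smooth_on I c"
    and V: "\<And>u. u \<in> I \<Longrightarrow> V u = a u *\<^sub>R tangent (\<lambda>x. X x t) u
      + b u *\<^sub>R normal (\<lambda>x. X x t) u + c u *\<^sub>R binormal (\<lambda>x. X x t) u"
begin

lemma partial_t_partial_u_frame:
  assumes u: "u \<in> I"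
  shows "partial_t (partial_u F) (u, t) =
    (vector_derivative a (at u) - S (u, t) * K (u, t) * b u) *\<^sub>R tangent (\<lambda>x. X x t) u
    + (vector_derivative b (at u) + S (u, t) * K (u, t) * a u
        - S (u, t) * torsion (\<lambda>x. X x t) u * c u) *\<^sub>R normal (\<lambda>x. X x t) u
    + (vector_derivative c (at u) + S (u, t) * torsion (\<lambda>x. X x t) u * b u) *\<^sub>R binormal (\<lambda>x. X x t) u"
proof (rule vector_derivative_unique_at[OF has_vector_derivative_velocity[OF u]],
    rule has_vector_derivative_transform_within_open[OF _ family_open(2) u])
  note D = smooth_on_has_vector_derivative[OF _ u]
  show "((\<lambda>u. a u *\<^sub>R tangent (\<lambda>x. X x t) u
      + b u *\<^sub>R normal (\<lambda>x. X x t) u + c u *\<^sub>R binormal (\<lambda>x. X x t) u) has_vector_derivative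
    (vector_derivative a (at u) - S (u, t) * K (u, t) * b u) *\<^sub>R tangent (\<lambda>x. X x t) u
    + (vector_derivative b (at u) + S (u, t) * K (u, t) * a u
        - S (u, t) * torsion (\<lambda>x. X x t) u * c u) *\<^sub>R normal (\<lambda>x. X x t) u
    + (vector_derivative c (at u) + S (u, t) * torsion (\<lambda>x. X x t) u * b u) *\<^sub>R binormal (\<lambda>x. X x t) u) (at u)"
    using has_vector_derivative_frame[OF family_curve[OF t] u D[OF a] D[OF b] D[OF c]]
    by (simp add: S_def K_def)
qed (simp add: V)

text \<open>The T-component of the derivative of the velocity along the curve.\<close>

lemma speed_evolution:
  assumes u: "u \<in> I"
  shows "partial_t S (u, t) = vector_derivative a (at u) - S (u, t) * K (u, t) * b u"
  unfolding partial_t_speed[OF u] partial_t_partial_u_frame[OF u]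
  by (rule frame_inner(1)[OF family_curve[OF t] u])

lemma arc_length_stationary_frame_iff:
  "(\<forall>a\<in>I. \<forall>b\<in>I. a \<le> b \<longrightarrow> ((\<lambda>r. arc_length (\<lambda>u. X u r) a b) has_real_derivative 0) (at t))
    \<longleftrightarrow> (\<forall>u\<in>I. vector_derivative a (at u) = speed (\<lambda>x. X x t) u * curvature (\<lambda>x. X x t) u * b u)"
  unfolding arc_length_stationary_iff
  by (rule ball_cong[OF refl]) (auto simp: speed_evolution[unfolded S_def K_def] S_def K_def)

text \<open>With \<open>b = 0\<close> and \<open>a' = 0\<close>, the time derivative of T is
  (\<kappa> a - \<tau> c) N + (c' / v) B. Differentiating once more along the curve, the N-component
  is (\<kappa> a - \<tau> c)' - \<tau> c', in which \<tau> c' occurs twice and \<kappa> a' drops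
  out.\<close>

lemma curvature_evolution:
  assumes a0: "\<And>u. u \<in> I \<Longrightarrow> vector_derivative a (at u) = 0" and b0: "\<And>u. u \<in> I \<Longrightarrow> b u = 0"
    and u: "u \<in> I"
  shows "((\<lambda>r. curvature (\<lambda>x. X x r) u) has_real_derivative
    (vector_derivative (curvature (\<lambda>x. X x t)) (at u) * a u
      - vector_derivative (torsion (\<lambda>x. X x t)) (at u) * c u
      - 2 * torsion (\<lambda>x. X x t) u * vector_derivative c (at u)) / speed (\<lambda>x. X x t) u) (at t)"
proof -
  let ?\<kappa> = "curvature (\<lambda>x. X x t)" and ?\<tau> = "torsion (\<lambda>x. X x t)" and ?v = "speed (\<lambda>x. X x t)"
  let ?T = "tangent (\<lambda>x. X x t)" and ?N = "normal (\<lambda>x. X x t)" and ?B = "binormal (\<lambda>x. X x t)"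
  define c' where "c' x = vector_derivative c (at x)" for x
  note cur = family_curve[OF t]
  note D = smooth_on_has_vector_derivative[OF _ u]
  have stat: "partial_t S (x, t) = 0" if "x \<in> I" for x
    using speed_evolution[OF that] a0[OF that] b0[OF that] by simp
  have b': "vector_derivative b (at x) = 0" if "x \<in> I" for x
    by (rule vector_derivative_at, rule has_vector_derivative_transform_within_open[OF
          has_vector_derivative_const[of 0] family_open(2) that]) (simp add: b0)
  have c's: "smooth_on I c'"
  proof (rule smooth_on_cong[OF family_open(2) _ smooth_on_frechet_derivative[OF c, of 1]])
    show "frechet_derivative c (at x) 1 = c' x" if "x \<in> I" for x
      using fun_cong[OF frechet_derivative_at[OF smooth_on_has_vector_derivative[OF c that,
            unfolded has_vector_derivative_def]], of 1] by (simp add: c'_def)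
  qed
  have vs: "smooth_on I (\<lambda>x. inverse (?v x))"
    by (rule smooth_on_inverse_compose[OF family_open(2) frenet_curve_smooth(6)[OF cur]])
      (rule less_imp_neq[OF frenet_curve_pos(1)[OF cur], symmetric])
  \<comment> \<open>The B-component of the time derivative of T; its smoothness is what permits the
    second differentiation.\<close>
  define w where "w = (\<lambda>x. inverse (?v x) * c' x)"
  have w: "smooth_on I w"
    unfolding w_def by (rule smooth_on_mult[OF family_open(2) vs c's])
  note k = D[OF frenet_curve_smooth(4)[OF cur]] and \<tau> = D[OF frenet_curve_smooth(5)[OF cur]]
  have m: "((\<lambda>x. ?\<kappa> x * a x - ?\<tau> x * c x) has_vector_derivative
      (?\<kappa> u * 0 + vector_derivative ?\<kappa> (at u) * a u)
      - (?\<tau> u * c' u + vector_derivative ?\<tau> (at u) * c u)) (at u)"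
    using has_vector_derivative_diff[OF has_vector_derivative_mult[OF k D[OF a]]
        has_vector_derivative_mult[OF \<tau> D[OF c]]] by (simp add: a0[OF u] c'_def)
  note fr = has_vector_derivative_frame[OF cur u has_vector_derivative_const[of 0] m D[OF w]]
  define D where "D = (0 - ?v u * ?\<kappa> u * (?\<kappa> u * a u - ?\<tau> u * c u)) *\<^sub>R ?T u
    + ((?\<kappa> u * 0 + vector_derivative ?\<kappa> (at u) * a u)
      - (?\<tau> u * c' u + vector_derivative ?\<tau> (at u) * c u) + ?v u * ?\<kappa> u * 0 - ?v u * ?\<tau> u * w u) *\<^sub>R ?N u
    + (vector_derivative w (at u) + ?v u * ?\<tau> u * (?\<kappa> u * a u - ?\<tau> u * c u)) *\<^sub>R ?B u"
  have der: "((\<lambda>x. partial_t (partial_u F) (x, t) /\<^sub>R S (x, t)) has_vector_derivative D) (at u)"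
    unfolding D_def
  proof (rule has_vector_derivative_transform_within_open[OF fr family_open(2) u])
    fix x assume x: "x \<in> I"
    show "0 *\<^sub>R ?T x + (?\<kappa> x * a x - ?\<tau> x * c x) *\<^sub>R ?N x + w x *\<^sub>R ?B x
        = partial_t (partial_u F) (x, t) /\<^sub>R S (x, t)"
      using frenet_curve_pos(1)[OF cur x]
      by (simp add: partial_t_partial_u_frame[OF x] a0[OF x] b0[OF x] b'[OF x] S_def K_def w_def c'_def
          algebra_simps)
  qed
  have "?N u \<bullet> D = (?\<kappa> u * 0 + vector_derivative ?\<kappa> (at u) * a u)
      - (?\<tau> u * c' u + vector_derivative ?\<tau> (at u) * c u) + ?v u * ?\<kappa> u * 0 - ?v u * ?\<tau> u * w u"
    unfolding D_def by (rule frame_inner(2)[OF cur u])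
  moreover have "?v u * ?\<tau> u * w u = ?\<tau> u * c' u"
    using frenet_curve_pos(1)[OF cur u] by (simp add: w_def)
  ultimately have N: "?N u \<bullet> D = vector_derivative ?\<kappa> (at u) * a u - vector_derivative ?\<tau> (at u) * c u
      - 2 * ?\<tau> u * vector_derivative c (at u)"
    by (simp add: c'_def)
  show ?thesis
    using curvature_has_derivative[OF stat u der] unfolding N by (simp add: S_def)
qed

end

end

subsection \<open>Variations with prescribed velocity\<close>

text \<open>Regularity, positive curvature and positive torsion are open conditions on (u, t) that
  hold at \<open>(u0, 0)\<close>, so they persist on a small square around this point.\<close>

lemma curve_family_of_variation:
  assumes \<gamma>: "positive_torsion_curve I \<gamma>" and V: "smooth_on I V" and u0: "u0 \<in> I"
  obtains I' J where "u0 \<in> I'" "0 \<in> J" "curve_family I' J (\<lambda>u t. \<gamma> u + t *\<^sub>R V u)"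
proof -
  have I: "open I" and s: "smooth_on I \<gamma>"
    using \<gamma> by (auto simp: positive_torsion_curve_def)
  define W where "W = I \<times> (UNIV :: real set)"
  have W: "open W"
    using I by (auto simp: W_def intro: open_Times)
  define F where "F = (\<lambda>p::real \<times> real. \<gamma> (fst p) + snd p *\<^sub>R V (fst p))"
  have "smooth_on W (\<lambda>p. \<gamma> (fst p))" "smooth_on W (\<lambda>p. V (fst p))"
    unfolding W_def by (intro smooth_on_fst I open_UNIV s V)+
  then have F: "smooth_on W F"
    unfolding F_def
    by (intro smooth_on_add[OF W] smooth_on_scaleR[OF W] smooth_on_linear[OF bounded_linear_snd W])
  have sl0: "slice F 0 = \<gamma>"
    by (simp add: F_def)
  \<comment> \<open>The domain shrinks in three stages, because the continuity of each quantity
    relies on the preceding condition: the curvature on \<open>W1\<close>, where the curves are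
    regular, and the torsion on \<open>W2\<close>, where the curvature is positive as well.\<close>
  define W1 where "W1 = W \<inter> partial_u F -` (-{0})"
  have W1: "open W1"
    unfolding W1_def
    by (rule continuous_open_preimage[OF smooth_on_imp_continuous_on[OF smooth_on_partial_u[OF F]] W]) auto
  have F1: "smooth_on W1 F"
    by (rule smooth_on_subset[OF F]) (simp add: W1_def)
  have reg1: "partial_u F p \<noteq> 0" if "p \<in> W1" for p
    using that by (simp add: W1_def)
  define W2 where "W2 = W1 \<inter> (\<lambda>(u, t). curvature (slice F t) u) -` {0<..}"
  have W2: "open W2"
    unfolding W2_def
  proof (rule continuous_open_preimage[OF _ W1])
    show "continuous_on W1 (\<lambda>(u, t). curvature (slice F t) u)"
      using continuous_on_norm[OF smooth_on_imp_continuous_on[OF smooth_on_arc_deriv_tangent[OF W1 F1 reg1]]]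
      by (simp add: curvature_def case_prod_unfold)
  qed auto
  have F2: "smooth_on W2 F"
    by (rule smooth_on_subset[OF F1]) (simp add: W2_def)
  have reg2: "partial_u F p \<noteq> 0" if "p \<in> W2" for p
    using that reg1 by (simp add: W2_def)
  have cur2: "curvature (slice F t) u > 0" if "(u, t) \<in> W2" for u t
    using that by (simp add: W2_def)
  define W3 where "W3 = W2 \<inter> (\<lambda>(u, t). torsion (slice F t) u) -` {0<..}"
  have W3: "open W3"
    unfolding W3_def
    by (rule continuous_open_preimage[OF smooth_on_imp_continuous_on[OF
            smooth_on_torsion[OF W2 F2 reg2 cur2]] W2]) auto
  have "partial_u F (u0, 0) = vector_derivative \<gamma> (at u0)"
    using vector_derivative_at[OF has_vector_derivative_partial_u[OF F, of u0 0]] u0 sl0 by (simp add: W_def)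
  then have "(u0, 0) \<in> W3"
    using \<gamma> u0 by (simp add: W3_def W2_def W1_def W_def sl0 positive_torsion_curve_def)
  then obtain e where e: "e > 0" "{u0 - e..u0 + e} \<times> ball 0 e \<subseteq> W3"
    using open_contains_square[OF W3] by blast
  define I' where "I' = {u0 - e<..<u0 + e}"
  define J where "J = ball (0::real) e"
  \<comment> \<open>The closed side of the square is replaced by its interior, since the domain of a
    curve must be open.\<close>
  have IJ: "I' \<times> J \<subseteq> W3"
    using e(2) by (force simp: I'_def J_def)
  have op: "open I'" "open J" "is_interval I'" "is_interval J"
    by (auto simp: I'_def J_def is_interval_convex_1)
  have "positive_torsion_curve I' (slice F t)" if t: "t \<in> J" for t
    unfolding positive_torsion_curve_def
  proof (intro conjI ballI op)
    show "smooth_on I' (slice F t)"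
      by (rule smooth_on_slice[OF op(1) W3 smooth_on_subset[OF F]])
        (use IJ t in \<open>auto simp: W3_def W2_def W1_def\<close>)
    fix u assume u: "u \<in> I'"
    then have p: "(u, t) \<in> W3" using IJ t by auto
    have "vector_derivative (slice F t) (at u) = partial_u F (u, t)"
      by (rule vector_derivative_at[OF has_vector_derivative_partial_u[OF F]])
        (use p in \<open>simp add: W3_def W2_def W1_def\<close>)
    then show "vector_derivative (slice F t) (at u) \<noteq> 0"
      using p by (simp add: W3_def W2_def W1_def)
    show "curvature (slice F t) u > 0" "torsion (slice F t) u > 0"
      using p by (simp_all add: W3_def W2_def)
  qed
  moreover have "smooth_on (I' \<times> J) F"
    by (rule smooth_on_subset[OF F]) (use IJ in \<open>auto simp: W3_def W2_def W1_def\<close>)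
  ultimately have fam: "curve_family I' J (\<lambda>u t. \<gamma> u + t *\<^sub>R V u)"
    using op by (simp add: curve_family_def F_def case_prod_unfold)
  show thesis
    using that[OF _ _ fam] e(1) by (simp add: I'_def J_def)
qed

section \<open>Coefficients evaluated along a curve\<close>

lemma curvature_domain_eq: "curvature_domain = {0<..} \<times> {0<..}"
  by (auto simp: curvature_domain_def)

lemma open_curvature_domain: "open curvature_domain"
  unfolding curvature_domain_eq by (intro open_Times open_greaterThan)

lemma curvature_torsion_in_domain:
  "positive_torsion_curve I \<gamma> \<Longrightarrow> u \<in> I \<Longrightarrow> (curvature \<gamma> u, torsion \<gamma> u) \<in> curvature_domain"
  by (simp add: positive_torsion_curve_def curvature_domain_def)

context
  fixes I :: "real set" and \<gamma> :: "real \<Rightarrow> real^3" and h :: coeff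
  assumes \<gamma>: "positive_torsion_curve I \<gamma>" and h: "smooth_on curvature_domain h"
begin

lemma smooth_on_coeff: "smooth_on I (\<lambda>u. h (curvature \<gamma> u, torsion \<gamma> u))"
proof -
  note f = positive_torsion_curve_imp_frenet_curve[OF \<gamma>]
  have I: "open I" by (rule frenet_curve_open[OF f])
  show ?thesis
    by (rule smooth_on_compose[where f = "\<lambda>u. (curvature \<gamma> u, torsion \<gamma> u)", OF I open_curvature_domain _
          smooth_on_Pair[OF I frenet_curve_smooth(4,5)[OF f]] h])
      (use curvature_torsion_in_domain[OF \<gamma>] in auto)
qed

lemma has_vector_derivative_coeff:
  assumes u: "u \<in> I"
  shows "((\<lambda>u. h (curvature \<gamma> u, torsion \<gamma> u)) has_vector_derivative
    frechet_derivative h (at (curvature \<gamma> u, torsion \<gamma> u))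
      (vector_derivative (curvature \<gamma>) (at u), vector_derivative (torsion \<gamma>) (at u))) (at u)"
proof -
  note f = positive_torsion_curve_imp_frenet_curve[OF \<gamma>]
  note D = smooth_on_has_derivative[OF h curvature_torsion_in_domain[OF \<gamma> u]]
  have "((\<lambda>u. (curvature \<gamma> u, torsion \<gamma> u)) has_vector_derivative
      (vector_derivative (curvature \<gamma>) (at u), vector_derivative (torsion \<gamma>) (at u))) (at u)"
    by (intro has_vector_derivative_Pair smooth_on_has_vector_derivative[OF _ u] frenet_curve_smooth[OF f])
  then have "((\<lambda>u. h (curvature \<gamma> u, torsion \<gamma> u)) has_derivative
      (\<lambda>d. frechet_derivative h (at (curvature \<gamma> u, torsion \<gamma> u))
        (d *\<^sub>R (vector_derivative (curvature \<gamma>) (at u), vector_derivative (torsion \<gamma>) (at u))))) (at u)"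
    unfolding has_vector_derivative_def
    by (rule has_derivative_compose[where f = "\<lambda>u. (curvature \<gamma> u, torsion \<gamma> u)", OF _ D])
  then show ?thesis
    unfolding has_vector_derivative_def linear_scale[OF has_derivative_linear[OF D]] .
qed

end

lemma smooth_on_velocity:
  assumes \<gamma>: "positive_torsion_curve I \<gamma>" and "smooth_on curvature_domain h1"
    "smooth_on curvature_domain h2" "smooth_on curvature_domain h3"
  shows "smooth_on I (velocity h1 h2 h3 \<gamma>)"
proof -
  note f = positive_torsion_curve_imp_frenet_curve[OF \<gamma>]
  note I = frenet_curve_open[OF f]
  show ?thesis
    unfolding velocity_def[abs_def]
    by (rule smooth_on_add[OF I smooth_on_add[OF I
            smooth_on_scaleR[OF I smooth_on_coeff[OF \<gamma> assms(2)] frenet_curve_smooth(1)[OF f]]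
            smooth_on_scaleR[OF I smooth_on_coeff[OF \<gamma> assms(3)] frenet_curve_smooth(2)[OF f]]]
          smooth_on_scaleR[OF I smooth_on_coeff[OF \<gamma> assms(4)] frenet_curve_smooth(3)[OF f]]])
qed

section \<open>Pointwise consequences of preservation\<close>

context
  fixes h1 h2 h3 :: coeff and I :: "real set" and \<gamma> :: "real \<Rightarrow> real^3" and u :: real
  assumes h: "smooth_on curvature_domain h1" "smooth_on curvature_domain h2" "smooth_on curvature_domain h3"
    and \<gamma>: "positive_torsion_curve I \<gamma>" and u: "u \<in> I"
begin

text \<open>Every curve has a family through it that obeys the law at time 0: the law is imposed at
  one instant only, so moving each point along a straight line with the prescribed velocity suffices
  and no evolution equation has to be solved.\<close>

lemma variation_by_velocity:
  obtains I' J X where "u \<in> I'" "0 \<in> J" "curve_family I' J X" "(\<lambda>x. X x 0) = \<gamma>"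
    "evolves_at h1 h2 h3 I' X 0"
proof -
  obtain I' J where *: "u \<in> I'" "0 \<in> J"
    "curve_family I' J (\<lambda>x t. \<gamma> x + t *\<^sub>R velocity h1 h2 h3 \<gamma> x)"
    using curve_family_of_variation[OF \<gamma> smooth_on_velocity[OF \<gamma> h] u] .
  have "((\<lambda>t. \<gamma> x + t *\<^sub>R velocity h1 h2 h3 \<gamma> x) has_vector_derivative velocity h1 h2 h3 \<gamma> x) (at 0)" for x
    by (auto intro!: derivative_eq_intros)
  then have "evolves_at h1 h2 h3 I' (\<lambda>x t. \<gamma> x + t *\<^sub>R velocity h1 h2 h3 \<gamma> x) 0"
    by (simp add: evolves_at_def vector_derivative_at)
  then show thesis
    using that * by simp
qed

text \<open>The length condition for the linear variation, read at one point: the chain rule turns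
  \<open>a' = v \<kappa> b\<close> into a relation between the values and first derivatives of
  curvature and torsion there.\<close>

lemma arclength_preserving_pointwise:
  assumes "arclength_preserving h1 h2 h3"
  shows "frechet_derivative h1 (at (curvature \<gamma> u, torsion \<gamma> u))
      (vector_derivative (curvature \<gamma>) (at u), vector_derivative (torsion \<gamma>) (at u))
    = speed \<gamma> u * curvature \<gamma> u * h2 (curvature \<gamma> u, torsion \<gamma> u)"
proof -
  obtain I' J X where *: "u \<in> I'" "0 \<in> J" "curve_family I' J X" and X0: "(\<lambda>x. X x 0) = \<gamma>"
    and ev: "evolves_at h1 h2 h3 I' X 0"
    using variation_by_velocity .
  \<comment> \<open>The variation exists on \<open>I'\<close> only, and \<gamma> is its slice at
    time 0.\<close>
  have \<gamma>': "positive_torsion_curve I' \<gamma>"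
    using *(2,3) X0 unfolding curve_family_def by metis
  have "\<forall>a\<in>I'. \<forall>b\<in>I'. a \<le> b \<longrightarrow> ((\<lambda>r. arc_length (\<lambda>u. X u r) a b) has_real_derivative 0) (at 0)"
    using assms *(2,3) ev unfolding arclength_preserving_def by blast
  then have "vector_derivative (\<lambda>u. h1 (curvature \<gamma> u, torsion \<gamma> u)) (at u) =
      speed \<gamma> u * curvature \<gamma> u * h2 (curvature \<gamma> u, torsion \<gamma> u)"
    using arc_length_stationary_frame_iff[OF *(3,2) smooth_on_coeff[OF \<gamma>' h(1)] smooth_on_coeff[OF \<gamma>' h(2)]
        smooth_on_coeff[OF \<gamma>' h(3)]] ev *(1)
    by (simp add: evolves_at_def velocity_def X0)
  then show ?thesis
    by (simp add: vector_derivative_at[OF has_vector_derivative_coeff[OF \<gamma> h(1) u]])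
qed

text \<open>With \<open>h1\<close> constant and \<open>h2\<close> zero the hypotheses of
  \<open>curvature_evolution\<close> hold, and its numerator must vanish because the speed is
  positive.\<close>

lemma curvature_preserving_pointwise:
  assumes "curvature_preserving h1 h2 h3"
    and h1: "\<And>p. p \<in> curvature_domain \<Longrightarrow> h1 p = A" and h2: "\<And>p. p \<in> curvature_domain \<Longrightarrow> h2 p = 0"
  shows "vector_derivative (curvature \<gamma>) (at u) * A
    - vector_derivative (torsion \<gamma>) (at u) * h3 (curvature \<gamma> u, torsion \<gamma> u)
    - 2 * torsion \<gamma> u * frechet_derivative h3 (at (curvature \<gamma> u, torsion \<gamma> u))
      (vector_derivative (curvature \<gamma>) (at u), vector_derivative (torsion \<gamma>) (at u)) = 0"
proof -
  obtain I' J X where *: "u \<in> I'" "0 \<in> J" "curve_family I' J X" and X0: "(\<lambda>x. X x 0) = \<gamma>"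
    and ev: "evolves_at h1 h2 h3 I' X 0"
    using variation_by_velocity .
  have \<gamma>': "positive_torsion_curve I' \<gamma>"
    using *(2,3) X0 unfolding curve_family_def by metis
  have I': "open I'"
    using \<gamma>' by (simp add: positive_torsion_curve_def)
  \<comment> \<open>Written with an explicit zero N-term, so that the velocity has the frame form
    with the constant functions \<open>A\<close> and 0 as its first two coefficients.\<close>
  have v: "vector_derivative (X x) (at 0) = A *\<^sub>R tangent (\<lambda>x. X x 0) x + 0 *\<^sub>R normal (\<lambda>x. X x 0) x
      + h3 (curvature \<gamma> x, torsion \<gamma> x) *\<^sub>R binormal (\<lambda>x. X x 0) x" if "x \<in> I'" for x
    using ev that curvature_torsion_in_domain[OF \<gamma>' that]
    by (simp add: evolves_at_def velocity_def X0 h1 h2)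
  have "((\<lambda>r. curvature (\<lambda>x. X x r) u) has_real_derivative 0) (at 0)"
    using assms(1) *(1,2,3) ev unfolding curvature_preserving_def by blast
  from DERIV_unique[OF this curvature_evolution[OF *(3,2) smooth_on_const[OF I'] smooth_on_const[OF I']
        smooth_on_coeff[OF \<gamma>' h(3)] v _ _ *(1)]]
  have "(vector_derivative (curvature \<gamma>) (at u) * A
    - vector_derivative (torsion \<gamma>) (at u) * h3 (curvature \<gamma> u, torsion \<gamma> u)
    - 2 * torsion \<gamma> u * vector_derivative (\<lambda>x. h3 (curvature \<gamma> x, torsion \<gamma> x)) (at u)) / speed \<gamma> u = 0"
    by (simp add: X0)
  then show ?thesis
    using frenet_curve_pos(1)[OF positive_torsion_curve_imp_frenet_curve[OF \<gamma>] u]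
    by (simp add: vector_derivative_at[OF has_vector_derivative_coeff[OF \<gamma> h(3) u]])
qed

end

subsection \<open>Curves with prescribed curvature and torsion to first order\<close>

text \<open>The derivative of the unit tangent is a nonzero multiple of \<gamma>2 plus a multiple of
  \<gamma>1. Its cross product with \<gamma>1 is thus a nonzero multiple of that of \<gamma>1 and
  \<gamma>2, so it cannot vanish and the curvature is positive.\<close>

lemma frenet_curveI:
  assumes I: "open I" and \<gamma>: "smooth_on I \<gamma>" and s: "smooth_on I \<gamma>1"
    and d1: "\<And>u. u \<in> I \<Longrightarrow> (\<gamma> has_vector_derivative \<gamma>1 u) (at u)"
    and d2: "\<And>u. u \<in> I \<Longrightarrow> (\<gamma>1 has_vector_derivative \<gamma>2 u) (at u)"
    and ne: "\<And>u. u \<in> I \<Longrightarrow> cross3 (\<gamma>1 u) (\<gamma>2 u) \<noteq> 0"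
  shows "frenet_curve I \<gamma>"
  unfolding frenet_curve_def
proof (intro conjI ballI I \<gamma>)
  fix u assume u: "u \<in> I"
  have v: "vector_derivative \<gamma> (at x) = \<gamma>1 x" if "x \<in> I" for x
    using d1[OF that] by (rule vector_derivative_at)
  have nz: "\<gamma>1 x \<noteq> 0" if "x \<in> I" for x
    using ne[OF that] by auto
  show "vector_derivative \<gamma> (at u) \<noteq> 0"
    using v nz u by simp
  have sp: "speed \<gamma> u \<noteq> 0"
    using v nz u by (simp add: speed_def)
  define w where "w x = inverse (norm (\<gamma>1 x))" for x
  have ws: "smooth_on I w"
    unfolding w_def[abs_def]
    by (intro smooth_on_inverse_compose[OF I] smooth_on_norm[OF I s]) (use nz in auto)
  define w' where "w' = vector_derivative w (at u)"
  have "((\<lambda>x. w x *\<^sub>R \<gamma>1 x) has_vector_derivative w u *\<^sub>R \<gamma>2 u + w' *\<^sub>R \<gamma>1 u) (at u)"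
    unfolding w'_def
    by (rule bounded_bilinear.has_vector_derivative[OF bounded_bilinear_scaleR
          smooth_on_has_vector_derivative[OF ws u] d2[OF u]])
  then have T: "(tangent \<gamma> has_vector_derivative w u *\<^sub>R \<gamma>2 u + w' *\<^sub>R \<gamma>1 u) (at u)"
    by (rule has_vector_derivative_transform_within_open[OF _ I u])
      (simp add: tangent_def arc_deriv_def speed_def w_def v)
  have "cross3 (\<gamma>1 u) (w u *\<^sub>R \<gamma>2 u + w' *\<^sub>R \<gamma>1 u) = w u *\<^sub>R cross3 (\<gamma>1 u) (\<gamma>2 u)"
    by (simp add: cross_add_right cross_mult_right)
  also have "\<dots> \<noteq> 0"
    using ne[OF u] nz[OF u] by (simp add: w_def)
  finally have "w u *\<^sub>R \<gamma>2 u + w' *\<^sub>R \<gamma>1 u \<noteq> 0"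
    by auto
  then show "curvature \<gamma> u > 0"
    using sp by (simp add: curvature_def arc_deriv_def vector_derivative_at[OF T])
qed

section \<open>Classical formulas for curvature and torsion in an arbitrary parameter\<close>

context
  fixes I :: "real set" and \<gamma> \<gamma>1 \<gamma>2 \<gamma>3 :: "real \<Rightarrow> real^3"
  assumes f: "frenet_curve I \<gamma>"
    and d1: "\<And>u. u \<in> I \<Longrightarrow> (\<gamma> has_vector_derivative \<gamma>1 u) (at u)"
    and d2: "\<And>u. u \<in> I \<Longrightarrow> (\<gamma>1 has_vector_derivative \<gamma>2 u) (at u)"
    and d3: "\<And>u. u \<in> I \<Longrightarrow> (\<gamma>2 has_vector_derivative \<gamma>3 u) (at u)"
begin

lemma second_derivative_frame:
  assumes u: "u \<in> I"
  shows "\<gamma>1 u = speed \<gamma> u *\<^sub>R tangent \<gamma> u"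
    and "\<gamma>2 u = (speed \<gamma> u ^ 2 * curvature \<gamma> u) *\<^sub>R normal \<gamma> u
      + vector_derivative (speed \<gamma>) (at u) *\<^sub>R tangent \<gamma> u"
proof -
  have *: "\<gamma>1 x = speed \<gamma> x *\<^sub>R tangent \<gamma> x" if "x \<in> I" for x
    using frenet_curve_pos(1)[OF f that]
    by (simp add: tangent_def arc_deriv_def vector_derivative_at[OF d1[OF that]])
  then show "\<gamma>1 u = speed \<gamma> u *\<^sub>R tangent \<gamma> u" using u .
  have "(\<gamma>1 has_vector_derivative speed \<gamma> u *\<^sub>R ((speed \<gamma> u * curvature \<gamma> u) *\<^sub>R normal \<gamma> u)
      + vector_derivative (speed \<gamma>) (at u) *\<^sub>R tangent \<gamma> u) (at u)"
    by (rule has_vector_derivative_transform_within_open[OF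
          bounded_bilinear.has_vector_derivative[OF bounded_bilinear_scaleR
            smooth_on_has_vector_derivative[OF frenet_curve_smooth(6)[OF f] u]
            has_vector_derivative_tangent[OF f u]] frenet_curve_open[OF f] u]) (simp add: *)
  from vector_derivative_unique_at[OF d2[OF u] this]
  show "\<gamma>2 u = (speed \<gamma> u ^ 2 * curvature \<gamma> u) *\<^sub>R normal \<gamma> u
      + vector_derivative (speed \<gamma>) (at u) *\<^sub>R tangent \<gamma> u"
    by (simp add: power2_eq_square mult.assoc)
qed

text \<open>The tangential part of \<gamma>2 is parallel to \<gamma>1 and disappears from the cross
  product.\<close>

lemma cross_derivatives:
  assumes u: "u \<in> I"
  shows "cross3 (\<gamma>1 u) (\<gamma>2 u) = (speed \<gamma> u ^ 3 * curvature \<gamma> u) *\<^sub>R binormal \<gamma> u"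
  unfolding second_derivative_frame[OF u]
  by (simp add: cross_add_right cross_mult_left cross_mult_right binormal_def power3_eq_cube
      power2_eq_square mult.assoc)

lemma norm_binormal: "u \<in> I \<Longrightarrow> norm (binormal \<gamma> u) = 1"
  using tangent_inner_tangent[OF f] normal_inner_normal[OF f] tangent_inner_normal[OF f]
  by (simp add: norm_eq_sqrt_inner binormal_def dot_cross)

lemma curvature_formula:
  assumes u: "u \<in> I"
  shows "curvature \<gamma> u = norm (cross3 (\<gamma>1 u) (\<gamma>2 u)) / norm (\<gamma>1 u) ^ 3"
proof -
  have "norm (\<gamma>1 u) = speed \<gamma> u"
    by (simp add: speed_def vector_derivative_at[OF d1[OF u]])
  then show ?thesis
    using frenet_curve_pos[OF f u] by (simp add: cross_derivatives[OF u] norm_binormal[OF u])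
qed

text \<open>\<open>cross_derivatives\<close> is differentiated on both sides: the left gives the
  cross product of \<gamma>1 and \<gamma>3, the right brings in the torsion through the derivative
  of B. The inner product with \<gamma>2 isolates the N-component.\<close>

lemma torsion_formula:
  assumes u: "u \<in> I"
  shows "torsion \<gamma> u = cross3 (\<gamma>1 u) (\<gamma>2 u) \<bullet> \<gamma>3 u / (norm (cross3 (\<gamma>1 u) (\<gamma>2 u)))\<^sup>2"
proof -
  let ?c = "\<lambda>x. speed \<gamma> x * (speed \<gamma> x * speed \<gamma> x) * curvature \<gamma> x"
  let ?v = "speed \<gamma> u" and ?\<kappa> = "curvature \<gamma> u" and ?\<tau> = "torsion \<gamma> u"
  note I = frenet_curve_open[OF f] and sm = frenet_curve_smooth[OF f]
  have c: "smooth_on I ?c"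
    by (intro smooth_on_mult[OF I] sm)
  have c_eq: "?c x = speed \<gamma> x ^ 3 * curvature \<gamma> x" for x
    by (simp add: power3_eq_cube)
  have 1: "((\<lambda>x. cross3 (\<gamma>1 x) (\<gamma>2 x)) has_vector_derivative
      cross3 (\<gamma>1 u) (\<gamma>3 u) + cross3 (\<gamma>2 u) (\<gamma>2 u)) (at u)"
    by (rule bounded_bilinear.has_vector_derivative[OF bounded_bilinear_cross3 d2[OF u] d3[OF u]])
  have 2: "((\<lambda>x. cross3 (\<gamma>1 x) (\<gamma>2 x)) has_vector_derivative
      ?c u *\<^sub>R (- (?v * ?\<tau>) *\<^sub>R normal \<gamma> u) + vector_derivative ?c (at u) *\<^sub>R binormal \<gamma> u) (at u)"
    by (rule has_vector_derivative_transform_within_open[OF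
          bounded_bilinear.has_vector_derivative[OF bounded_bilinear_scaleR
            smooth_on_has_vector_derivative[OF c u] has_vector_derivative_binormal[OF f u]] I u])
      (simp add: cross_derivatives c_eq)
  \<comment> \<open>Exchanging the last two vectors of a triple product changes its sign.\<close>
  have "cross3 (\<gamma>1 u) (\<gamma>2 u) \<bullet> \<gamma>3 u = - (cross3 (\<gamma>1 u) (\<gamma>3 u) \<bullet> \<gamma>2 u)"
    by (simp add: cross3_simps)
  also have "cross3 (\<gamma>1 u) (\<gamma>3 u) =
      ?c u *\<^sub>R (- (?v * ?\<tau>) *\<^sub>R normal \<gamma> u) + vector_derivative ?c (at u) *\<^sub>R binormal \<gamma> u"
    using vector_derivative_unique_at[OF 1 2] by simp
  also have "\<dots> \<bullet> \<gamma>2 u = - (?c u * ?v * ?\<tau> * (?v ^ 2 * ?\<kappa>))"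
    unfolding second_derivative_frame(2)[OF u]
    using normal_inner_normal[OF f u] tangent_inner_normal[OF f u]
    by (simp add: inner_add_left inner_add_right inner_diff_left binormal_def dot_cross_self
        inner_commute[of "normal \<gamma> u" "tangent \<gamma> u"])
  finally have "cross3 (\<gamma>1 u) (\<gamma>2 u) \<bullet> \<gamma>3 u = ?\<tau> * (?v ^ 3 * ?\<kappa>)\<^sup>2"
    by (simp add: power2_eq_square power3_eq_cube)
  then show ?thesis
    using frenet_curve_pos[OF f u] by (simp add: cross_derivatives[OF u] norm_binormal[OF u])
qed

end

text \<open>A linear combination of the axis vectors, so that derivatives and smoothness are
  obtained term by term.\<close>

definition vec3 :: "real \<Rightarrow> real \<Rightarrow> real \<Rightarrow> real^3" where
  "vec3 a b c = a *\<^sub>R axis 1 1 + b *\<^sub>R axis 2 1 + c *\<^sub>R axis 3 1"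

lemma vec3_nth [simp]: "vec3 a b c $ 1 = a" "vec3 a b c $ 2 = b" "vec3 a b c $ 3 = c"
  by (simp_all add: vec3_def axis_def)

lemma cross3_vec3:
  "cross3 (vec3 a b c) (vec3 a' b' c') = vec3 (b * c' - c * b') (c * a' - a * c') (a * b' - b * a')"
  by (simp add: vec_eq_iff forall_3 cross_components)

lemma inner_vec3: "vec3 a b c \<bullet> vec3 a' b' c' = a * a' + b * b' + c * c'"
  by (simp add: inner_vec_def sum_3)

lemma norm_vec3: "norm (vec3 a b c) = sqrt (a\<^sup>2 + b\<^sup>2 + c\<^sup>2)"
  by (simp add: norm_eq_sqrt_inner inner_vec3 power2_eq_square)

lemma has_vector_derivative_vec3:
  assumes "(f has_real_derivative f') (at x)" "(g has_real_derivative g') (at x)"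
    "(h has_real_derivative h') (at x)"
  shows "((\<lambda>x. vec3 (f x) (g x) (h x)) has_vector_derivative vec3 f' g' h') (at x)"
  unfolding vec3_def
  using assms by (auto intro!: derivative_eq_intros)

lemma smooth_on_vec3:
  assumes "open S" "smooth_on S f" "smooth_on S g" "smooth_on S h"
  shows "smooth_on S (\<lambda>x. vec3 (f x) (g x) (h x))"
  unfolding vec3_def by (intro smooth_on_add smooth_on_scaleR smooth_on_const assms)

lemma smooth_on_power:
  fixes f :: "'a::euclidean_space \<Rightarrow> real"
  assumes "open S" "smooth_on S f"
  shows "smooth_on S (\<lambda>x. f x ^ n)"
  by (induction n) (auto intro: smooth_on_const smooth_on_mult assms)

text \<open>A polynomial curve whose derivatives at 0 up to the fourth order are chosen to produce
  the four given numbers. Its speed is 1 to first order at 0, so the speed contributes nothing to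
  the first derivative of the curvature.\<close>

lemma positive_torsion_curve_with_jet:
  fixes k w p r :: real
  assumes k: "k > 0" and w: "w > 0"
  obtains I \<gamma> where "positive_torsion_curve I \<gamma>" "0 \<in> I" "speed \<gamma> 0 = 1"
    "curvature \<gamma> 0 = k" "torsion \<gamma> 0 = w"
    "vector_derivative (curvature \<gamma>) (at 0) = p" "vector_derivative (torsion \<gamma>) (at 0) = r"
proof -
  \<comment> \<open>Solves \<open>(q - 2 * p * w) / k = r\<close>, the left side being the
    derivative of the torsion at 0.\<close>
  define q where "q = k * r + 2 * p * w"
  define \<gamma> where "\<gamma> x = vec3 x (k * x^2 / 2 + p * x^3 / 6) (k * w * x^3 / 6 + q * x^4 / 24)" for x
  define y where "y x = k * x + p * x^2 / 2" for x
  define z where "z x = k * w * x^2 / 2 + q * x^3 / 6" for x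
  define y1 where "y1 x = k + p * x" for x
  define z1 where "z1 x = k * w * x + q * x^2 / 2" for x
  define z2 where "z2 x = k * w + q * x" for x
  have dy: "(y has_real_derivative y1 x) (at x)" for x
    unfolding y_def[abs_def] y1_def by (auto intro!: derivative_eq_intros)
  have dz: "(z has_real_derivative z1 x) (at x)" for x
    unfolding z_def[abs_def] z1_def by (auto intro!: derivative_eq_intros)
  have dy1: "(y1 has_real_derivative p) (at x)" for x
    unfolding y1_def[abs_def] by (auto intro!: derivative_eq_intros)
  have dz1: "(z1 has_real_derivative z2 x) (at x)" for x
    unfolding z1_def[abs_def] z2_def by (auto intro!: derivative_eq_intros)
  have dz2: "(z2 has_real_derivative q) (at x)" for x
    unfolding z2_def[abs_def] by (auto intro!: derivative_eq_intros)
  let ?\<gamma>1 = "\<lambda>x. vec3 1 (y x) (z x)" and ?\<gamma>2 = "\<lambda>x. vec3 0 (y1 x) (z1 x)" and ?\<gamma>3 = "\<lambda>x. vec3 0 p (z2 x)"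
  have d1: "(\<gamma> has_vector_derivative ?\<gamma>1 x) (at x)" for x
    unfolding \<gamma>_def[abs_def]
    by (rule has_vector_derivative_vec3) (auto intro!: derivative_eq_intros simp: y_def z_def field_simps)
  have d2: "(?\<gamma>1 has_vector_derivative ?\<gamma>2 x) (at x)" for x
    by (intro has_vector_derivative_vec3 dy dz DERIV_const)
  have d3: "(?\<gamma>2 has_vector_derivative ?\<gamma>3 x) (at x)" for x
    by (intro has_vector_derivative_vec3 dy1 dz1 DERIV_const)
  \<comment> \<open>\<open>y1\<close> is the third component of the cross product of the first two
    derivatives, so on this set the curve is regular with positive curvature.\<close>
  define I1 where "I1 = {x. y1 x > 0}"
  have I1: "open I1"
    unfolding I1_def y1_def by (intro open_Collect_less continuous_intros)
  have id: "smooth_on I1 (\<lambda>x. x)"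
    by (rule smooth_on_linear[OF bounded_linear_ident I1])
  have sx: "smooth_on I1 (\<lambda>x. c * x ^ n / d)" for c d :: real and n
    using smooth_on_mult[OF I1 smooth_on_const[OF I1, of "c / d"] smooth_on_power[OF I1 id, of n]] by simp
  have s: "smooth_on I1 \<gamma>"
    unfolding \<gamma>_def[abs_def] by (intro smooth_on_vec3 smooth_on_add I1 id sx)
  have s1: "smooth_on I1 ?\<gamma>1"
    unfolding y_def z_def
    using sx[of k 1 1] by (intro smooth_on_vec3 smooth_on_add smooth_on_const I1 sx) simp
  have ne: "cross3 (?\<gamma>1 x) (?\<gamma>2 x) \<noteq> 0" if "x \<in> I1" for x
  proof -
    have "cross3 (?\<gamma>1 x) (?\<gamma>2 x) $ 3 \<noteq> 0"
      using that by (simp add: cross3_vec3 I1_def)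
    then show ?thesis by auto
  qed
  have f: "frenet_curve I1 \<gamma>"
    by (rule frenet_curveI[OF I1 s s1 d1 d2 ne])
  have at_zero: "0 \<in> I1" "y 0 = 0" "z 0 = 0" "y1 0 = k" "z1 0 = 0" "z2 0 = k * w"
    using k by (auto simp: I1_def y_def z_def y1_def z1_def z2_def)
  \<comment> \<open>With the classical formulas in mind: \<open>R\<close> is the squared length of
    the first derivative, \<open>Q\<close> that of the cross product of the first two derivatives,
    and \<open>M\<close> the triple product of the first three.\<close>
  define R where "R x = 1 + (y x)\<^sup>2 + (z x)\<^sup>2" for x
  define Q where "Q x = (y x * z1 x - z x * y1 x)\<^sup>2 + (z1 x)\<^sup>2 + (y1 x)\<^sup>2" for x
  define M where "M x = y1 x * z2 x - z1 x * p" for x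
  have \<kappa>: "curvature \<gamma> x = sqrt (Q x) / sqrt (R x) ^ 3" if "x \<in> I1" for x
    unfolding curvature_formula[OF f d1 d2 d3 that] cross3_vec3 norm_vec3 by (simp add: Q_def R_def)
  have \<tau>: "torsion \<gamma> x = M x / Q x" if "x \<in> I1" for x
    unfolding torsion_formula[OF f d1 d2 d3 that] cross3_vec3 norm_vec3 inner_vec3
    by (simp add: Q_def M_def mult.commute)
  have at0: "Q 0 = k\<^sup>2" "R 0 = 1" "M 0 = k\<^sup>2 * w"
    by (simp_all add: Q_def R_def M_def at_zero power2_eq_square)
  have dQ: "(Q has_real_derivative 2 * k * p) (at 0)"
    unfolding Q_def[abs_def]
    by (auto intro!: derivative_eq_intros dy dz dy1 dz1 simp: at_zero)
  have dR: "(R has_real_derivative 0) (at 0)"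
    unfolding R_def[abs_def]
    by (auto intro!: derivative_eq_intros dy dz simp: at_zero)
  have dM: "(M has_real_derivative k * q) (at 0)"
    unfolding M_def[abs_def]
    by (auto intro!: derivative_eq_intros dy1 dz1 dz2 simp: at_zero)
  have sQ: "((\<lambda>x. sqrt (Q x)) has_real_derivative p) (at 0)"
    using DERIV_chain2[OF DERIV_real_sqrt dQ] k by (simp add: at0 field_simps)
  have sR: "((\<lambda>x. sqrt (R x) ^ 3) has_real_derivative 0) (at 0)"
    using DERIV_power[OF DERIV_chain2[OF DERIV_real_sqrt dR], of 3] by (simp add: at0)
  have "((\<lambda>x. sqrt (Q x) / sqrt (R x) ^ 3) has_real_derivative p) (at 0)"
    using DERIV_divide[OF sQ sR] by (simp add: at0)
  then have \<kappa>': "vector_derivative (curvature \<gamma>) (at 0) = p"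
    unfolding has_real_derivative_iff_has_vector_derivative
    by (rule vector_derivative_at[OF has_vector_derivative_transform_within_open[OF _ I1 at_zero(1)]]) (simp_all add: \<kappa>)
  have "((\<lambda>x. M x / Q x) has_real_derivative (k * q * k\<^sup>2 - k\<^sup>2 * w * (2 * k * p)) / (k\<^sup>2 * k\<^sup>2)) (at 0)"
    using DERIV_divide[OF dM dQ] k by (simp add: at0)
  also have "(k * q * k\<^sup>2 - k\<^sup>2 * w * (2 * k * p)) / (k\<^sup>2 * k\<^sup>2) = r"
    using k by (simp add: q_def power2_eq_square field_simps)
  finally have \<tau>': "vector_derivative (torsion \<gamma>) (at 0) = r"
    unfolding has_real_derivative_iff_has_vector_derivative
    by (rule vector_derivative_at[OF has_vector_derivative_transform_within_open[OF _ I1 at_zero(1)]]) (simp_all add: \<tau>)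
  have k0: "curvature \<gamma> 0 = k" and t0: "torsion \<gamma> 0 = w"
    using k by (simp_all add: \<kappa>[OF at_zero(1)] \<tau>[OF at_zero(1)] at0)
  have sp0: "speed \<gamma> 0 = 1"
    by (simp add: speed_def vector_derivative_at[OF d1] norm_vec3 at_zero)
  \<comment> \<open>The torsion is known to be positive only at 0, hence by continuity near
    0.\<close>
  have "open (I1 \<inter> torsion \<gamma> -` {0<..})"
    by (rule continuous_open_preimage[OF smooth_on_imp_continuous_on[OF frenet_curve_smooth(5)[OF f]] I1]) auto
  moreover have "0 \<in> I1 \<inter> torsion \<gamma> -` {0<..}"
    using at_zero(1) w t0 by simp
  ultimately obtain e where e: "e > 0" "ball 0 e \<subseteq> I1 \<inter> torsion \<gamma> -` {0<..}"
    using open_contains_ball by blast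
  have "positive_torsion_curve (ball 0 e) \<gamma>"
    unfolding positive_torsion_curve_def
    using f e(2) smooth_on_subset[OF s]
    by (auto simp: frenet_curve_def is_interval_convex_1)
  then show thesis
    using that[of "ball 0 e" \<gamma>] e(1) sp0 k0 t0 \<kappa>' \<tau>' by simp
qed

subsection \<open>Determining the coefficients\<close>

context
  fixes h1 h2 h3 :: coeff
  assumes h: "smooth_on curvature_domain h1" "smooth_on curvature_domain h2" "smooth_on curvature_domain h3"
begin

text \<open>In \<open>eq\<close> the left side is linear in \<open>(p, r)\<close> while the right
  side does not involve them. Setting both to 0 gives \<open>h2 = 0\<close>; then the derivative of
  \<open>h1\<close> vanishes in all directions, and the domain is convex.\<close>

lemma arclength_preserving_coeffs:
  assumes "arclength_preserving h1 h2 h3"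
  obtains A where "\<And>p. p \<in> curvature_domain \<Longrightarrow> h1 p = A" "\<And>p. p \<in> curvature_domain \<Longrightarrow> h2 p = 0"
proof -
  have eq: "frechet_derivative h1 (at (k, w)) (p, r) = k * h2 (k, w)" if kw: "k > 0" "w > 0" for k w p r
  proof -
    obtain I \<gamma> where j: "positive_torsion_curve I \<gamma>" "0 \<in> I" "speed \<gamma> 0 = 1"
      "curvature \<gamma> 0 = k" "torsion \<gamma> 0 = w"
      "vector_derivative (curvature \<gamma>) (at 0) = p" "vector_derivative (torsion \<gamma>) (at 0) = r"
      using positive_torsion_curve_with_jet[OF kw] .
    show ?thesis
      using arclength_preserving_pointwise[OF h j(1,2) assms] by (simp add: j)
  qed
  have lin: "linear (frechet_derivative h1 (at x))" if "x \<in> curvature_domain" for x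
    using smooth_on_has_derivative[OF h(1) that] by (rule has_derivative_linear)
  have h2: "h2 x = 0" if x: "x \<in> curvature_domain" for x
  proof -
    obtain k w where kw: "x = (k, w)" "k > 0" "w > 0"
      using x by (auto simp: curvature_domain_def)
    show ?thesis
      using eq[OF kw(2,3), of 0 0] linear_0[OF lin[OF x]] kw by (simp add: zero_prod_def[symmetric])
  qed
  have "(h1 has_derivative (\<lambda>_. 0)) (at x within curvature_domain)" if x: "x \<in> curvature_domain" for x
  proof -
    obtain k w where kw: "x = (k, w)" "k > 0" "w > 0"
      using x by (auto simp: curvature_domain_def)
    have "frechet_derivative h1 (at x) = (\<lambda>_. 0)"
      using h2[OF x] by (auto simp: fun_eq_iff kw(1) eq[OF kw(2,3)])
    then show ?thesis
      using has_derivative_at_withinI[OF smooth_on_has_derivative[OF h(1) x]] by simp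
  qed
  moreover have "convex curvature_domain"
    unfolding curvature_domain_eq by (rule convex_Times) (simp_all add: convex_real_interval)
  ultimately obtain A where "\<And>p. p \<in> curvature_domain \<Longrightarrow> h1 p = A"
    using has_derivative_zero_constant[of curvature_domain h1] by metis
  then show thesis
    using that h2 by metis
qed

text \<open>Taking \<open>r = 0\<close> and \<open>p = 0\<close> in turn splits \<open>eq\<close>
  into the two partial derivatives of \<open>h3\<close>. One makes \<open>h3 (k, w) * sqrt w\<close>
  independent of \<open>w\<close>, the other makes \<open>h3 (k, w) - A * k / (2 * w)\<close>
  independent of \<open>k\<close>; together these are compatible only with
  \<open>A = 0\<close>.\<close>

lemma curvature_preserving_coeffs:
  assumes "curvature_preserving h1 h2 h3"
    and A: "\<And>p. p \<in> curvature_domain \<Longrightarrow> h1 p = A" and h2: "\<And>p. p \<in> curvature_domain \<Longrightarrow> h2 p = 0"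
  obtains C where "A = 0" "\<And>k w. k > 0 \<Longrightarrow> w > 0 \<Longrightarrow> h3 (k, w) = C / sqrt w"
proof -
  define D where "D k w = frechet_derivative h3 (at (k, w))" for k w
  have eq: "p * A - r * h3 (k, w) - 2 * w * D k w (p, r) = 0" if kw: "k > 0" "w > 0" for k w p r
  proof -
    obtain I \<gamma> where j: "positive_torsion_curve I \<gamma>" "0 \<in> I" "speed \<gamma> 0 = 1"
      "curvature \<gamma> 0 = k" "torsion \<gamma> 0 = w"
      "vector_derivative (curvature \<gamma>) (at 0) = p" "vector_derivative (torsion \<gamma>) (at 0) = r"
      using positive_torsion_curve_with_jet[OF kw] .
    show ?thesis
      using curvature_preserving_pointwise[OF h j(1,2) assms] by (simp add: j D_def)
  qed
  have hD: "(h3 has_derivative D k w) (at (k, w))" if "k > 0" "w > 0" for k w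
    unfolding D_def using that by (intro smooth_on_has_derivative[OF h(3)]) (simp add: curvature_domain_def)
  have dk: "((\<lambda>k. h3 (k, w)) has_real_derivative A / (2 * w)) (at k)" if kw: "k > 0" "w > 0" for k w
  proof -
    have "((\<lambda>k. h3 (k, w)) has_derivative (\<lambda>d. D k w (d, 0))) (at k)"
      by (rule has_derivative_compose[OF has_derivative_Pair[OF has_derivative_ident has_derivative_const] hD[OF kw]])
    moreover have "(\<lambda>d. D k w (d, 0)) = (*) (A / (2 * w))"
      using eq[OF kw, of _ 0] kw by (auto simp: fun_eq_iff field_simps)
    ultimately show ?thesis
      by (simp only: has_field_derivative_def)
  qed
  have dw: "((\<lambda>w. h3 (k, w)) has_real_derivative - h3 (k, w) / (2 * w)) (at w)" if kw: "k > 0" "w > 0" for k w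
  proof -
    have "((\<lambda>w. h3 (k, w)) has_derivative (\<lambda>d. D k w (0, d))) (at w)"
      by (rule has_derivative_compose[OF has_derivative_Pair[OF has_derivative_const has_derivative_ident] hD[OF kw]])
    moreover have "(\<lambda>d. D k w (0, d)) = (*) (- h3 (k, w) / (2 * w))"
      using eq[OF kw, of 0] kw by (auto simp: fun_eq_iff field_simps)
    ultimately show ?thesis
      by (simp only: has_field_derivative_def)
  qed
  have gw: "h3 (k, w) * sqrt w = h3 (k, 1)" if kw: "k > 0" "w > 0" for k w
  proof -
    have "((\<lambda>w. h3 (k, w) * sqrt w) has_real_derivative 0) (at w)" if "w \<in> {0<..}" for w
    proof -
      \<comment> \<open>With \<open>w = s * s\<close> the cancellation becomes an identity of
        rational functions.\<close>
      define s where "s = sqrt w"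
      have s: "s > 0" "w = s * s"
        using that by (simp_all add: s_def)
      have "((\<lambda>w. h3 (k, w) * sqrt w) has_real_derivative
          - h3 (k, w) / (2 * w) * s + inverse s / 2 * h3 (k, w)) (at w)"
        using DERIV_mult[OF dw[of k w] DERIV_real_sqrt[of w]] that kw(1) by (simp add: s_def)
      moreover have "- h3 (k, w) / (2 * w) * s + inverse s / 2 * h3 (k, w) = 0"
        using s(1) by (simp add: s(2) field_simps)
      ultimately show ?thesis by simp
    qed
    from constant_on_interval[of "{0<..}" "\<lambda>w. h3 (k, w) * sqrt w" w 1, OF _ this] show ?thesis
      using kw(2) by (simp add: is_interval_convex_1)
  qed
  have gk: "h3 (k, w) - A / (2 * w) * k = h3 (1, w) - A / (2 * w)" if kw: "k > 0" "w > 0" for k w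
  proof -
    have "((\<lambda>k. h3 (k, w) - A / (2 * w) * k) has_real_derivative 0) (at k)" if "k \<in> {0<..}" for k
      using DERIV_diff[OF dk[of k w] DERIV_cmult[OF DERIV_ident, of "A / (2 * w)" k]] that kw(2) by simp
    from constant_on_interval[of "{0<..}" "\<lambda>k. h3 (k, w) - A / (2 * w) * k" k 1, OF _ this] show ?thesis
      using kw(1) by (simp add: is_interval_convex_1)
  qed
  \<comment> \<open>The increment of \<open>h3\<close> from \<open>k = 1\<close> to
    \<open>k = 2\<close> is \<open>A / (2 * w)\<close>, hence A/2 at \<open>w = 1\<close> and A/8 at
    \<open>w = 4\<close>. By \<open>gw\<close> the increment at \<open>w = 4\<close> is half of that
    at \<open>w = 1\<close>, that is, A/4.\<close>
  have A: "A = 0"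
    using gk[of 2 1] gk[of 2 4] gw[of 1 4] gw[of 2 4] by simp
  have "h3 (k, w) = h3 (1, 1) / sqrt w" if "k > 0" "w > 0" for k w
    using gw[OF that] gk[OF that(1), of 1] that A by (simp add: field_simps)
  then show thesis
    using that A by blast
qed

end

text \<open>The hypothesis fixes the velocity, so the evolution formulas can be applied with zero T-
  and N-coefficients and \<open>c\<close> equal to the constant \<open>C\<close> divided by the
  square root of the torsion. This \<open>c\<close> satisfies \<tau>' c + 2 \<tau> c' = 0.\<close>

lemma equivalent_imp_preserving:
  assumes "equivalent_up_to_rescaling (h1, h2, h3) (\<lambda>_. 0, \<lambda>_. 0, \<lambda>(\<kappa>, \<tau>). 1 / sqrt \<tau>)"
  shows "curvature_preserving h1 h2 h3" "arclength_preserving h1 h2 h3"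
proof -
  obtain C where vel: "\<And>I \<gamma> u. positive_torsion_curve I \<gamma> \<Longrightarrow> u \<in> I \<Longrightarrow>
      velocity h1 h2 h3 \<gamma> u = C *\<^sub>R velocity (\<lambda>_. 0) (\<lambda>_. 0) (\<lambda>(\<kappa>, \<tau>). 1 / sqrt \<tau>) \<gamma> u"
    using assms unfolding equivalent_up_to_rescaling_def by auto
  {
    fix I J X and t :: real
    assume fam: "curve_family I J X" and t: "t \<in> J" and ev: "evolves_at h1 h2 h3 I X t"
    let ?\<gamma> = "\<lambda>u. X u t"
    have \<gamma>: "positive_torsion_curve I ?\<gamma>"
      using fam t by (simp add: curve_family_def)
    note f = positive_torsion_curve_imp_frenet_curve[OF \<gamma>]
    note I = frenet_curve_open[OF f]
    have \<tau>: "torsion ?\<gamma> u > 0" if "u \<in> I" for u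
      using \<gamma> that by (simp add: positive_torsion_curve_def)
    define c where "c u = inverse (sqrt (torsion ?\<gamma> u)) * C" for u
    have c: "smooth_on I c"
      unfolding c_def[abs_def]
    proof (intro smooth_on_mult[OF I] smooth_on_inverse_compose[OF I] smooth_on_const[OF I])
      show "smooth_on I (\<lambda>u. sqrt (torsion ?\<gamma> u))"
        by (rule smooth_on_compose[OF I _ _ frenet_curve_smooth(5)[OF f] smooth_on_sqrt]) (use \<tau> in auto)
    qed (use \<tau> in force)
    have v: "vector_derivative (X u) (at t) = 0 *\<^sub>R tangent ?\<gamma> u + 0 *\<^sub>R normal ?\<gamma> u + c u *\<^sub>R binormal ?\<gamma> u"
      if "u \<in> I" for u
      using ev that vel[OF \<gamma> that]
      by (simp add: evolves_at_def velocity_def c_def field_simps)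
    have "\<forall>a\<in>I. \<forall>b\<in>I. a \<le> b \<longrightarrow> ((\<lambda>r. arc_length (\<lambda>u. X u r) a b) has_real_derivative 0) (at t)"
      by (subst arc_length_stationary_frame_iff[OF fam t smooth_on_const[OF I] smooth_on_const[OF I] c v]) simp_all
    moreover have "((\<lambda>r. curvature (\<lambda>u. X u r) u) has_real_derivative 0) (at t)" if u: "u \<in> I" for u
    proof -
      let ?\<tau> = "torsion ?\<gamma>"
      let ?\<tau>' = "vector_derivative ?\<tau> (at u)"
      have d\<tau>: "(?\<tau> has_real_derivative ?\<tau>') (at u)"
        unfolding has_real_derivative_iff_has_vector_derivative
        by (rule smooth_on_has_vector_derivative[OF frenet_curve_smooth(5)[OF f] u])
      define s where "s = sqrt (?\<tau> u)"
      have s: "s > 0" "?\<tau> u = s * s"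
        using \<tau>[OF u] by (simp_all add: s_def)
      have "(c has_real_derivative - (inverse s * (inverse s / 2 * ?\<tau>') * inverse s) * C) (at u)"
        unfolding c_def[abs_def] s_def
        by (intro DERIV_cmult_right DERIV_inverse' DERIV_chain2[OF DERIV_real_sqrt d\<tau>] \<tau> u)
          (use \<tau>[OF u] in simp)
      then have "vector_derivative c (at u) = - (inverse s * (inverse s / 2 * ?\<tau>') * inverse s) * C"
        unfolding has_real_derivative_iff_has_vector_derivative by (rule vector_derivative_at)
      \<comment> \<open>With \<tau> = \<open>s * s\<close> one has \<open>c = C / s\<close> and c' =
        - C \<tau>' / (2 s^3), so the two terms cancel.\<close>
      then have "- (?\<tau>' * c u) - 2 * ?\<tau> u * vector_derivative c (at u) = 0"
        using s(1) unfolding s(2) c_def by (simp add: field_simps)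
      then show ?thesis
        using curvature_evolution[OF fam t smooth_on_const[OF I] smooth_on_const[OF I] c v _ _ u] by simp
    qed
    ultimately have "(\<forall>a\<in>I. \<forall>b\<in>I. a \<le> b \<longrightarrow>
        ((\<lambda>r. arc_length (\<lambda>u. X u r) a b) has_real_derivative 0) (at t)) \<and>
      (\<forall>u\<in>I. ((\<lambda>r. curvature (\<lambda>u. X u r) u) has_real_derivative 0) (at t))"
      by blast
  }
  note * = this
  show "curvature_preserving h1 h2 h3" "arclength_preserving h1 h2 h3"
    unfolding curvature_preserving_def arclength_preserving_def using * by blast+
qed

theorem theorem2p2:
  fixes h1 h2 h3 :: "real \<times> real \<Rightarrow> real"
  assumes "smooth_on curvature_domain h1"
    and "smooth_on curvature_domain h2"
    and "smooth_on curvature_domain h3"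
    and nontrivial: "\<exists>p\<in>curvature_domain. h1 p \<noteq> 0 \<or> h2 p \<noteq> 0 \<or> h3 p \<noteq> 0"
  shows "curvature_preserving h1 h2 h3 \<and> arclength_preserving h1 h2 h3 \<longleftrightarrow>
    equivalent_up_to_rescaling (h1, h2, h3) (\<lambda>_. 0, \<lambda>_. 0, \<lambda>(\<kappa>, \<tau>). 1 / sqrt \<tau>)"
proof
  assume *: "curvature_preserving h1 h2 h3 \<and> arclength_preserving h1 h2 h3"
  obtain A where A: "\<And>p. p \<in> curvature_domain \<Longrightarrow> h1 p = A"
    and h2: "\<And>p. p \<in> curvature_domain \<Longrightarrow> h2 p = 0"
    using arclength_preserving_coeffs[OF assms(1-3)] * by blast
  obtain C where "A = 0" and h3: "\<And>k w. k > 0 \<Longrightarrow> w > 0 \<Longrightarrow> h3 (k, w) = C / sqrt w"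
    using curvature_preserving_coeffs[OF assms(1-3) conjunct1[OF *] A h2] by blast
  \<comment> \<open>\<open>nontrivial\<close> enters here: for \<open>C = 0\<close> all three
    coefficients would vanish on the domain. The zero law preserves length and curvature, but it is
    not a nonzero multiple of the model law.\<close>
  have "C \<noteq> 0"
    using nontrivial A h2 h3 \<open>A = 0\<close> by (auto simp: curvature_domain_def)
  moreover have "velocity h1 h2 h3 \<gamma> u = C *\<^sub>R velocity (\<lambda>_. 0) (\<lambda>_. 0) (\<lambda>(\<kappa>, \<tau>). 1 / sqrt \<tau>) \<gamma> u"
    if \<gamma>: "positive_torsion_curve I \<gamma>" and u: "u \<in> I" for I \<gamma> u
  proof -
    have "curvature \<gamma> u > 0" "torsion \<gamma> u > 0"
      using \<gamma> u by (auto simp: positive_torsion_curve_def)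
    then show ?thesis
      using A h2 h3 \<open>A = 0\<close> by (simp add: velocity_def curvature_domain_def)
  qed
  ultimately show "equivalent_up_to_rescaling (h1, h2, h3) (\<lambda>_. 0, \<lambda>_. 0, \<lambda>(\<kappa>, \<tau>). 1 / sqrt \<tau>)"
    unfolding equivalent_up_to_rescaling_def by auto
qed (simp add: equivalent_imp_preserving)

end
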